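(* In the setting fixed in the context, suppose that $$\int_{t_0}^{+\infty}\epsilon(t)\,dt<+\infty,\qquad \lim_{t\to+\infty}\beta(t)\epsilon(t)=+\infty,\qquad \dot\beta(t)\le\frac1\delta\beta(t)\ \text{ for all } t\ge t_0,\qquad \frac1\delta\le\gamma .$$ Let $(\bar x^*,\bar y^* )=\mathrm{proj}_S 0$ and let $(x,y,\lambda):[t_0,+\infty)\to\mathcal{X}\times\mathcal{Y}\times\mathcal{Z}$ be a solution of the dynamical system (DS). Then $$\liminf_{t\to+\infty}\|(x(t),y(t))-(\bar x^*,\bar y^* )\|=0 .$$ In addition, if there exists $T\ge t_0$ such that the trajectory $\{(x(t),y(t)):t\ge T\}$ stays either in the ball $\mathbb{B}\left(0,\sqrt{\|\bar x^*\|^2+\|\bar y^*\|^2}\right)$ or in its complement, then $$\lim_{t\to+\infty}\|(x(t),y(t))-(\bar x^*,\bar y^* )\|=0 .$$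
   Context: Let $\mathcal{X},\mathcal{Y},\mathcal{Z}$ be real Hilbert spaces, $A:\mathcal{X}\to\mathcal{Z}$ and $B:\mathcal{Y}\to\mathcal{Z}$ continuous linear operators with adjoints $A^\top,B^\top$, and $b\in\mathcal{Z}$. The norm on $\mathcal{X}\times\mathcal{Y}$ is $\|(x,y)\|=\sqrt{\|x\|^2+\|y\|^2}$, and $\mathbb{B}(0,r)$ is the closed ball of $\mathcal{X}\times\mathcal{Y}$ centered at $0$ with radius $r$. Let $f:\mathcal{X}\to\mathbb{R}$ and $g:\mathcal{Y}\to\mathbb{R}$ be continuously differentiable convex functions, with $\nabla f$ $l_1$-Lipschitz continuous ($l_1>0$) and $\nabla g$ $l_2$-Lipschitz continuous ($l_2>0$). $S\subseteq\mathcal{X}\times\mathcal{Y}$ is the solution set of the problem of minimizing $f(x)+g(y)$ over $(x,y)\in\mathcal{X}\times\mathcal{Y}$ subject to $Ax+By=b$. $\mathrm{proj}_S$ is the projection operator onto $S$, so $\mathrm{proj}_S0$ is the element of minimal norm of $S$. The augmented Lagrangian is $$\mathcal{L}(x,y,\lambda)=f(x)+g(y)+\langle\lambda,Ax+By-b\rangle+\tfrac12\|Ax+By-b\|^2 ,$$ and it is assumed that its set $\Omega$ of saddle points is nonempty (so $S\ne\emptyset$), where $(x^*,y^*,\lambda^* )\in\Omega$ iff $\mathcal{L}(x^*,y^*,\lambda)\le\mathcal{L}(x^*,y^*,\lambda^* )\le\mathcal{L}(x,y,\lambda^* )$ for all $(x,y,\lambda)\in\mathcal{X}\times\mathcal{Y}\times\mathcal{Z}$.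 Let $t_0>0$, $\gamma>0$, $\delta>0$ be constants; $\beta:[t_0,+\infty)\to(0,+\infty)$ is non-decreasing and continuously differentiable; $\epsilon:[t_0,+\infty)\to[0,+\infty)$ is non-increasing and continuously differentiable with $\lim_{t\to+\infty}\epsilon(t)=0$. The dynamical system (DS) is, for $t\ge t_0$, $$\begin{cases}\ddot{x}(t)+\gamma\dot{x}(t)+\beta(t)\big(\nabla f(x(t))+A^\top\lambda(t)+A^\top(Ax(t)+By(t)-b)+\epsilon(t)x(t)\big)=0,\\ \ddot{y}(t)+\gamma\dot{y}(t)+\beta(t)\big(\nabla g(y(t))+B^\top\lambda(t)+B^\top(Ax(t)+By(t)-b)+\epsilon(t)y(t)\big)=0,\\ \dot{\lambda}(t)-\beta(t)\big(A(x(t)+\delta\dot{x}(t))+B(y(t)+\delta\dot{y}(t))-b\big)=0,\end{cases}$$ and a solution is a triple $(x,y,\lambda)$ with $x,y$ twice differentiable and $\lambda$ differentiable satisfying these equations for all $t\ge t_0$. *)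

theory Defs
  imports "HOL-Analysis.Analysis"
begin

text \<open>
  The metric projection of a point onto a set. The library's \<open>closest_point\<close> is only available
  for Heine-Borel spaces, hence not for infinite-dimensional Hilbert spaces.
\<close>

definition metric_proj :: "'a::metric_space set \<Rightarrow> 'a \<Rightarrow> 'a" where
  "metric_proj S a = (THE p. p \<in> S \<and> (\<forall>q\<in>S. dist a p \<le> dist a q))"

definition feasible_set ::
  "('a \<Rightarrow> 'c) \<Rightarrow> ('b \<Rightarrow> 'c) \<Rightarrow> 'c::real_inner \<Rightarrow> ('a \<times> 'b) set" where
  "feasible_set A B b = {(x, y). A x + B y = b}"

definition solution_set ::
  "('a \<Rightarrow> real) \<Rightarrow> ('b \<Rightarrow> real) \<Rightarrow> ('a \<Rightarrow> 'c) \<Rightarrow> ('b \<Rightarrow> 'c) \<Rightarrow> 'c::real_inner \<Rightarrow> ('a \<times> 'b) set" where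
  "solution_set f g A B b =
    {(x, y). (x, y) \<in> feasible_set A B b \<and>
             (\<forall>(u, v) \<in> feasible_set A B b. f x + g y \<le> f u + g v)}"

definition aug_lagrangian ::
  "('a \<Rightarrow> real) \<Rightarrow> ('b \<Rightarrow> real) \<Rightarrow> ('a \<Rightarrow> 'c) \<Rightarrow> ('b \<Rightarrow> 'c) \<Rightarrow> 'c::real_inner \<Rightarrow>
    'a \<Rightarrow> 'b \<Rightarrow> 'c \<Rightarrow> real" where
  "aug_lagrangian f g A B b x y l =
    f x + g y + l \<bullet> (A x + B y - b) + 1 / 2 * (norm (A x + B y - b))\<^sup>2"

definition saddle_points ::
  "('a \<Rightarrow> real) \<Rightarrow> ('b \<Rightarrow> real) \<Rightarrow> ('a \<Rightarrow> 'c) \<Rightarrow> ('b \<Rightarrow> 'c) \<Rightarrow> 'c::real_inner \<Rightarrow>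
    ('a \<times> 'b \<times> 'c) set" where
  "saddle_points f g A B b =
    {(xs, ys, ls). \<forall>x y l.
       aug_lagrangian f g A B b xs ys l \<le> aug_lagrangian f g A B b xs ys ls \<and>
       aug_lagrangian f g A B b xs ys ls \<le> aug_lagrangian f g A B b x y ls}"

text \<open>
  Trajectories are total functions on the reals of which only the values on \<open>{t0..}\<close> matter;
  derivatives are taken within \<open>{t0..}\<close>, so they are one-sided at \<open>t0\<close> and two-sided elsewhere.
  The arguments \<open>gf\<close> and \<open>gg\<close> stand for the gradients of the two objective functions.
\<close>

definition is_DS_solution ::
  "real \<Rightarrow> real \<Rightarrow> real \<Rightarrow> (real \<Rightarrow> real) \<Rightarrow> (real \<Rightarrow> real) \<Rightarrow>
    ('a \<Rightarrow> 'a) \<Rightarrow> ('b \<Rightarrow> 'b) \<Rightarrow> ('a::real_inner \<Rightarrow> 'c) \<Rightarrow> ('b::real_inner \<Rightarrow> 'c) \<Rightarrow> 'c::real_inner \<Rightarrow>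
    (real \<Rightarrow> 'a) \<Rightarrow> (real \<Rightarrow> 'b) \<Rightarrow> (real \<Rightarrow> 'c) \<Rightarrow> bool" where
  "is_DS_solution t0 \<gamma> \<delta> \<beta> \<epsilon> gf gg A B b x y l \<longleftrightarrow>
    (\<exists>x' x'' y' y'' l'. \<forall>t\<ge>t0.
       (x has_vector_derivative x' t) (at t within {t0..}) \<and>
       (x' has_vector_derivative x'' t) (at t within {t0..}) \<and>
       (y has_vector_derivative y' t) (at t within {t0..}) \<and>
       (y' has_vector_derivative y'' t) (at t within {t0..}) \<and>
       (l has_vector_derivative l' t) (at t within {t0..}) \<and>
       x'' t + \<gamma> *\<^sub>R x' t + \<beta> t *\<^sub>R (gf (x t) + adjoint A (l t)
         + adjoint A (A (x t) + B (y t) - b) + \<epsilon> t *\<^sub>R x t) = 0 \<and>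
       y'' t + \<gamma> *\<^sub>R y' t + \<beta> t *\<^sub>R (gg (y t) + adjoint B (l t)
         + adjoint B (A (x t) + B (y t) - b) + \<epsilon> t *\<^sub>R y t) = 0 \<and>
       l' t - \<beta> t *\<^sub>R (A (x t + \<delta> *\<^sub>R x' t) + B (y t + \<delta> *\<^sub>R y' t) - b) = 0)"

end

theory Submission
  imports Defs
begin

text \<open>
  Work with \<open>u = (x, y)\<close> on the product space and \<open>\<phi> = \<L>(\<cdot>, \<lambda>\<^sup>*)\<close> for a fixed dual solution
  \<open>\<lambda>\<^sup>*\<close>, whose minimizers are exactly the solutions of the constrained problem; let \<open>u\<^sup>*\<close> be the one
  of minimal norm. For a real \<open>c\<close>, consider the energy \<open>E\<^sub>c\<close>, the sum of
  \<open>\<delta>\<^sup>2 \<beta> (\<phi>(u) - \<phi>(u\<^sup>*) + \<epsilon>/2 (\<parallel>u\<parallel>\<^sup>2 - c))\<close>, \<open>1/2 \<parallel>u - u\<^sup>* + \<delta> u'\<parallel>\<^sup>2\<close>,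
  \<open>(\<delta>\<gamma> - 1)/2 \<parallel>u - u\<^sup>*\<parallel>\<^sup>2\<close> and \<open>\<delta>/2 \<parallel>\<lambda> - \<lambda>\<^sup>*\<parallel>\<^sup>2\<close>. As long as \<open>\<parallel>u\<parallel>\<^sup>2 \<ge> c\<close>, it is nonnegative
  and its derivative is at most \<open>\<delta>/2 \<beta> \<epsilon> (\<parallel>u\<^sup>*\<parallel>\<^sup>2 - c - \<parallel>u - u\<^sup>*\<parallel>\<^sup>2)\<close>.

  For \<open>c = 0\<close> this gives \<open>E\<^sub>0/\<beta> \<longlongrightarrow> 0\<close>, hence \<open>\<phi>(u(t)) \<longlongrightarrow> min \<phi>\<close>. By the parallelogram identity,
  points of the ball of radius \<open>\<parallel>u\<^sup>*\<parallel>\<close> that almost minimize \<open>\<phi>\<close> are close to \<open>u\<^sup>*\<close> in norm, which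
  settles the times at which the trajectory lies in the ball.
  For \<open>c = \<parallel>u\<^sup>*\<parallel>\<^sup>2\<close> and a trajectory that eventually stays outside the ball, \<open>E\<^sub>c\<close> is nonincreasing
  with \<open>E\<^sub>c' \<le> - \<delta>/2 \<parallel>u - u\<^sup>*\<parallel>\<^sup>2\<close>. The derivative of \<open>\<parallel>u - u\<^sup>*\<parallel>\<^sup>2\<close> is bounded above, so adding a
  multiple of \<open>E\<^sub>c\<close> to \<open>\<parallel>u - u\<^sup>*\<parallel>\<^sup>4\<close> yields a second nonincreasing function, and \<open>\<parallel>u - u\<^sup>*\<parallel>\<close> converges;
  its limit must be \<open>0\<close>.
\<close>

section \<open>Minimal norm points and adjoints in Hilbert spaces\<close>

text \<open>Parallelogram identity. In a convex set, \<open>r\<close> can be any lower bound for the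
  norms, so points of nearly minimal norm lie close to each other.\<close>

lemma norm_diff_sq_le_of_midpoint:
  fixes p q :: "'a::real_inner"
  assumes "r \<ge> 0" "r \<le> norm ((1/2) *\<^sub>R (p + q))"
  shows "(norm (p - q))\<^sup>2 \<le> 2 * (norm p)\<^sup>2 + 2 * (norm q)\<^sup>2 - 4 * r\<^sup>2"
proof -
  have "r\<^sup>2 \<le> (norm ((1/2) *\<^sub>R (p + q)))\<^sup>2"
    using assms by (intro power_mono)
  then have "4 * r\<^sup>2 \<le> (norm (p + q))\<^sup>2"
    by (simp add: power_mult_distrib power2_eq_square)
  then show ?thesis
    by (simp add: power2_norm_eq_inner inner_add_left inner_add_right inner_diff_left
        inner_diff_right inner_commute)
qed

lemma Cauchy_of_norm_diff_sq_le:
  fixes p :: "nat \<Rightarrow> 'a::real_normed_vector" and d :: "nat \<Rightarrow> real"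
  assumes "d \<longlonglongrightarrow> 0" "\<And>m n. n \<le> m \<Longrightarrow> (norm (p m - p n))\<^sup>2 \<le> d n"
  shows "Cauchy p"
proof (rule metric_CauchyI)
  fix e :: real assume "e > 0"
  then have "\<forall>\<^sub>F n in sequentially. d n < (e/2)\<^sup>2"
    using assms(1) by (intro order_tendstoD(2)) auto
  then obtain N where "d N < (e/2)\<^sup>2"
    by (auto simp: eventually_sequentially)
  then have "norm (p m - p N) < e/2" if "m \<ge> N" for m
    using le_less_trans[OF assms(2)[OF that] \<open>d N < (e/2)\<^sup>2\<close>] \<open>e > 0\<close>
    by (intro power2_less_imp_less[of _ "e/2"]) simp_all
  then show "\<exists>M. \<forall>m\<ge>M. \<forall>n\<ge>M. dist (p m) (p n) < e"
    by (metis dist_norm dist_triangle_half_l)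
qed

text \<open>A minimizing sequence is Cauchy by the midpoint estimate; completeness and closedness
  then replace compactness.\<close>

lemma ex_min_norm_point:
  fixes S :: "'a::{real_inner, complete_space} set"
  assumes "closed S" "convex S" "S \<noteq> {}"
  shows "\<exists>p\<in>S. \<forall>q\<in>S. norm p \<le> norm q"
proof -
  define r where "r = Inf (norm ` S)"
  have bdd: "bdd_below (norm ` S)"
    by (auto intro!: bdd_belowI[of _ 0])
  have r_le: "r \<le> norm q" if "q \<in> S" for q
    unfolding r_def using bdd that by (intro cInf_lower) auto
  have r0: "r \<ge> 0"
    unfolding r_def using assms(3) by (intro cInf_greatest) auto
  have "\<exists>q\<in>S. norm q < r + 1 / Suc n" for n
  proof -
    have "r < r + 1 / real (Suc n)" by simp
    then show ?thesis
      unfolding r_def using assms(3) bdd by (subst (asm) cInf_less_iff) auto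
  qed
  then obtain p where p: "\<And>n. p n \<in> S" "\<And>n. norm (p n) < r + 1 / Suc n"
    by metis
  \<comment> \<open>From index \<open>n\<close> on, all norms are at most
    \<open>r + 1 / Suc n\<close>; the midpoint estimate then has this bound.\<close>
  let ?d = "\<lambda>n. 4 * (r + 1 / real (Suc n))\<^sup>2 - 4 * r\<^sup>2"
  have "(\<lambda>n. r + 1 / real (Suc n)) \<longlonglongrightarrow> r + 0"
    by (intro tendsto_intros) (use LIMSEQ_inverse_real_of_nat in \<open>simp add: inverse_eq_divide\<close>)
  then have lim: "(\<lambda>n. r + 1 / real (Suc n)) \<longlonglongrightarrow> r" by simp
  then have "?d \<longlonglongrightarrow> 4 * r\<^sup>2 - 4 * r\<^sup>2"
    by (intro tendsto_intros)
  then have "?d \<longlonglongrightarrow> 0" by simp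
  moreover have "(norm (p m - p n))\<^sup>2 \<le> ?d n" if "n \<le> m" for m n
  proof -
    have "(1/2) *\<^sub>R (p m + p n) \<in> S"
      using convexD[OF assms(2) p(1) p(1), of "1/2" "1/2" m n] by (simp add: scaleR_add_right)
    from norm_diff_sq_le_of_midpoint[OF r0 r_le[OF this]]
    have "(norm (p m - p n))\<^sup>2 \<le> 2 * (norm (p m))\<^sup>2 + 2 * (norm (p n))\<^sup>2 - 4 * r\<^sup>2" .
    moreover have "norm (p m) \<le> r + 1 / Suc n"
      using p(2)[of m] that by (smt (verit) frac_le of_nat_0_less_iff of_nat_le_iff zero_less_Suc Suc_le_mono)
    moreover have "norm (p n) \<le> r + 1 / Suc n"
      using p(2)[of n] by simp
    ultimately show ?thesis
      by (smt (verit) norm_ge_zero power_mono)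
  qed
  ultimately have "Cauchy p"
    by (rule Cauchy_of_norm_diff_sq_le)
  then obtain q where q: "p \<longlonglongrightarrow> q"
    using Cauchy_convergent convergent_def by blast
  have "q \<in> S"
    using closed_sequentially[OF assms(1)] p(1) q by blast
  moreover have "norm q \<le> r"
    using p(2) by (intro LIMSEQ_le[OF tendsto_norm[OF q] lim]) (auto intro: less_imp_le)
  ultimately show ?thesis
    using r_le by (meson order_trans)
qed

lemma min_norm_point_unique:
  fixes S :: "'a::real_inner set"
  assumes "convex S" "p \<in> S" "q \<in> S" "\<And>r. r \<in> S \<Longrightarrow> norm p \<le> norm r" "\<And>r. r \<in> S \<Longrightarrow> norm q \<le> norm r"
  shows "p = q"
proof -
  have "(1/2) *\<^sub>R (p + q) \<in> S"
    using convexD[OF assms(1-3), of "1/2" "1/2"] by (simp add: scaleR_add_right)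
  then have "(norm (p - q))\<^sup>2 \<le> 2 * (norm p)\<^sup>2 + 2 * (norm q)\<^sup>2 - 4 * (norm p)\<^sup>2"
    by (intro norm_diff_sq_le_of_midpoint assms) auto
  moreover have "norm p = norm q"
    using assms by (meson order_antisym)
  ultimately show ?thesis by simp
qed

text \<open>Existence and uniqueness of the point of minimal norm give the description operator in
  \<open>metric_proj\<close> its meaning.\<close>

lemma metric_proj_zero:
  fixes S :: "'a::{real_inner, complete_space} set"
  assumes "closed S" "convex S" "S \<noteq> {}"
  shows "metric_proj S 0 \<in> S" "q \<in> S \<Longrightarrow> norm (metric_proj S 0) \<le> norm q"
proof -
  have "\<exists>!p. p \<in> S \<and> (\<forall>q\<in>S. dist 0 p \<le> dist 0 q)"
    using ex_min_norm_point[OF assms] min_norm_point_unique[OF assms(2)]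
    by (metis dist_0_norm)
  from theI'[OF this] show "metric_proj S 0 \<in> S" "q \<in> S \<Longrightarrow> norm (metric_proj S 0) \<le> norm q"
    by (auto simp: metric_proj_def)
qed

text \<open>The point \<open>p\<close> of minimal norm on the hyperplane \<open>\<phi> = 1\<close>
  is orthogonal to the kernel, and every \<open>x\<close> differs from
  \<open>\<phi> x *\<^sub>R p\<close> by a kernel element.\<close>

lemma riesz_representation:
  fixes \<phi> :: "'a::{real_inner, complete_space} \<Rightarrow> real"
  assumes "bounded_linear \<phi>"
  shows "\<exists>v. \<forall>x. \<phi> x = x \<bullet> v"
proof (cases "\<forall>x. \<phi> x = 0")
  case True
  then have "\<forall>x. \<phi> x = x \<bullet> 0" by simp
  then show ?thesis by blast
next
  case False
  interpret bounded_linear \<phi> by fact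
  let ?S = "{x. \<phi> x = 1}"
  from False obtain x0 where x0: "\<phi> x0 \<noteq> 0" by blast
  then have "\<phi> (x0 /\<^sub>R \<phi> x0) = 1"
    by (simp add: scaleR)
  then have ne: "?S \<noteq> {}" by blast
  have cl: "closed ?S"
    using closed_vimage[of "{1}" \<phi>] linear_continuous_on[OF assms, of UNIV]
    by (simp add: vimage_def)
  have cv: "convex ?S"
    by (auto simp: convex_def add scaleR)
  obtain p where p: "\<phi> p = 1" "\<And>q. \<phi> q = 1 \<Longrightarrow> norm p \<le> norm q"
    using ex_min_norm_point[OF cl cv ne] by auto
  have orth: "z \<bullet> p = 0" if z: "\<phi> z = 0" for z
  proof (cases "z = 0")
    case False
    \<comment> \<open>The minimizer of the quadratic
      \<open>s \<mapsto> (norm (p + s *\<^sub>R z))\<^sup>2\<close>.\<close>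
    let ?s = "- (z \<bullet> p) / (z \<bullet> z)"
    have "norm p \<le> norm (p + ?s *\<^sub>R z)"
      by (intro p(2)) (simp only: add scaleR p(1) z, simp)
    then have "p \<bullet> p \<le> (p + ?s *\<^sub>R z) \<bullet> (p + ?s *\<^sub>R z)"
      by (simp only: norm_le)
    also have "\<dots> = p \<bullet> p + 2 * ?s * (z \<bullet> p) + ?s * ?s * (z \<bullet> z)"
      by (simp only: inner_add_left inner_add_right inner_scaleR_left inner_scaleR_right
          inner_commute[of p z] distrib_left)
    also have "\<dots> = p \<bullet> p - (z \<bullet> p)\<^sup>2 / (z \<bullet> z)"
      using False by (simp add: field_simps power2_eq_square)
    finally have "(z \<bullet> p)\<^sup>2 / (z \<bullet> z) \<le> 0" by simp
    moreover have "z \<bullet> z > 0" using False by simp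
    ultimately have "(z \<bullet> p)\<^sup>2 \<le> 0"
      unfolding divide_le_0_iff by linarith
    then show ?thesis by simp
  qed simp
  have "p \<noteq> 0" using p(1) zero by force
  have "\<phi> x = x \<bullet> (p /\<^sub>R (p \<bullet> p))" for x
  proof -
    have "(x - \<phi> x *\<^sub>R p) \<bullet> p = 0"
      by (intro orth) (simp add: diff scaleR p(1))
    then show ?thesis
      using \<open>p \<noteq> 0\<close> by (simp add: inner_diff_left field_simps)
  qed
  then show ?thesis by blast
qed

text \<open>\<open>adjoint\<close> is defined by choice, so its equation holds once some adjoint
  exists; Riesz provides one pointwise in \<open>y\<close>.\<close>

lemma adjoint_hilbert:
  fixes A :: "'a::{real_inner, complete_space} \<Rightarrow> 'c::real_inner"
  assumes "bounded_linear A"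
  shows "x \<bullet> adjoint A y = A x \<bullet> y"
proof -
  have "\<exists>v. \<forall>x. A x \<bullet> y = x \<bullet> v" for y
    by (intro riesz_representation bounded_linear_compose[OF bounded_linear_inner_left assms])
  then have "\<exists>A'. \<forall>x y. A x \<bullet> y = x \<bullet> A' y" by metis
  then have "\<forall>x y. A x \<bullet> y = x \<bullet> adjoint A y"
    unfolding adjoint_def by (rule someI_ex)
  then show ?thesis by simp
qed

section \<open>Convex functions and monotone real functions\<close>

text \<open>Restriction to the line through \<open>u\<close> and \<open>w\<close> reduces this to
  the tangent inequality for real functions.\<close>

lemma convex_on_above_tangent:
  fixes \<phi> :: "'a::real_normed_vector \<Rightarrow> real"
  assumes "convex_on UNIV \<phi>" "(\<phi> has_derivative \<phi>') (at u)"
  shows "\<phi> u + \<phi>' (w - u) \<le> \<phi> w"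
proof -
  define h where "h = (\<lambda>s::real. \<phi> (u + s *\<^sub>R (w - u)))"
  have "convex_on UNIV h"
  proof (rule convex_onI)
    fix t a b :: real assume "0 < t" "t < 1"
    have "u + ((1 - t) *\<^sub>R a + t *\<^sub>R b) *\<^sub>R (w - u) =
          (1 - t) *\<^sub>R (u + a *\<^sub>R (w - u)) + t *\<^sub>R (u + b *\<^sub>R (w - u))"
      by (simp add: algebra_simps)
    then show "h ((1 - t) *\<^sub>R a + t *\<^sub>R b) \<le> (1 - t) * h a + t * h b"
      unfolding h_def using convex_onD[OF assms(1), of t] \<open>0 < t\<close> \<open>t < 1\<close> by simp
  qed auto
  moreover have "(h has_real_derivative \<phi>' (w - u)) (at 0)"
  proof -
    have "((\<lambda>s::real. u + s *\<^sub>R (w - u)) has_derivative (\<lambda>s. s *\<^sub>R (w - u))) (at 0)"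
      by (auto intro!: derivative_eq_intros)
    then have "(h has_derivative (\<lambda>s. \<phi>' (s *\<^sub>R (w - u)))) (at 0)"
      unfolding h_def by (rule has_derivative_compose) (use assms(2) in simp)
    moreover have "(\<lambda>s. \<phi>' (s *\<^sub>R (w - u))) = (*) (\<phi>' (w - u))"
      using linear_scale[OF has_derivative_linear[OF assms(2)]] by (simp add: fun_eq_iff mult.commute)
    ultimately show ?thesis by (simp add: has_field_derivative_def)
  qed
  ultimately have "\<phi>' (w - u) * (1 - 0) \<le> h 1 - h 0"
    by (intro convex_on_imp_above_tangent[where A=UNIV]) auto
  then show ?thesis by (simp add: h_def)
qed

lemma convex_sublevel:
  assumes "convex_on UNIV \<phi>"
  shows "convex {w. \<phi> w \<le> c}"
proof (rule convexI)
  fix v w and s t :: real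
  assume *: "v \<in> {w. \<phi> w \<le> c}" "w \<in> {w. \<phi> w \<le> c}" "0 \<le> s" "0 \<le> t" "s + t = 1"
  then have "\<phi> (s *\<^sub>R v + t *\<^sub>R w) \<le> s * \<phi> v + t * \<phi> w"
    using assms by (simp add: convex_on_def)
  also have "\<dots> \<le> c"
    using * by (intro convex_bound_le) auto
  finally show "s *\<^sub>R v + t *\<^sub>R w \<in> {w. \<phi> w \<le> c}" by simp
qed

text \<open>The minimal norms over the shrinking sublevel sets \<open>D n\<close> increase to
  \<open>norm m\<close>. A point of \<open>D n\<close> inside the ball of radius
  \<open>norm m\<close> thus has almost minimal norm in \<open>D n\<close>, as has \<open>m\<close>,
  and the midpoint estimate brings the two together.\<close>

lemma min_norm_minimizer_well_posed:
  fixes \<phi> :: "'a::{real_inner, complete_space} \<Rightarrow> real"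
  assumes conv: "convex_on UNIV \<phi>" and cont: "continuous_on UNIV \<phi>"
    and minim: "\<And>w. \<phi> m \<le> \<phi> w" and min_norm: "\<And>w. \<phi> w = \<phi> m \<Longrightarrow> norm m \<le> norm w"
    and "e > 0"
  shows "\<exists>d>0. \<forall>w. \<phi> w \<le> \<phi> m + d \<and> norm w \<le> norm m \<longrightarrow> norm (w - m) < e"
proof -
  define D where "D = (\<lambda>n. {w. \<phi> w \<le> \<phi> m + 1 / Suc n})"
  have m_in: "m \<in> D n" for n
    by (simp add: D_def)
  have D_closed: "closed (D n)" for n
    unfolding D_def by (intro closed_Collect_le cont continuous_on_const)
  have D_convex: "convex (D n)" for n
    using convex_sublevel[OF conv] by (simp add: D_def)
  have D_anti: "D k \<subseteq> D n" if "n \<le> k" for n k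
    using frac_le[of 1 1 "real (Suc n)" "real (Suc k)"] that by (auto simp: D_def)
  have "\<exists>p\<in>D n. \<forall>q\<in>D n. norm p \<le> norm q" for n
    using m_in by (intro ex_min_norm_point D_closed D_convex) auto
  then obtain p where p: "\<And>n. p n \<in> D n" "\<And>n q. q \<in> D n \<Longrightarrow> norm (p n) \<le> norm q"
    by metis
  have mid: "(norm (v - w))\<^sup>2 \<le> 2 * (norm v)\<^sup>2 + 2 * (norm w)\<^sup>2 - 4 * (norm (p n))\<^sup>2"
    if "v \<in> D n" "w \<in> D n" for v w n
    using convexD[OF D_convex that, of "1/2" "1/2"]
    by (intro norm_diff_sq_le_of_midpoint p(2)) (simp_all add: scaleR_add_right)
  have inc: "incseq (\<lambda>n. norm (p n))"
    using p D_anti by (intro incseq_SucI) (meson le_Suc_eq order_refl subsetD)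
  obtain R where R: "(\<lambda>n. norm (p n)) \<longlonglongrightarrow> R" "\<And>n. norm (p n) \<le> R"
    using incseq_convergent[OF inc, of "norm m"] p(2) m_in by blast
  have "R \<le> norm m"
    using p(2) m_in by (intro LIMSEQ_le_const2[OF R(1)]) auto
  have "Cauchy p"
  proof (rule Cauchy_of_norm_diff_sq_le)
    have "(\<lambda>n. 2 * R\<^sup>2 - 2 * (norm (p n))\<^sup>2) \<longlonglongrightarrow> 2 * R\<^sup>2 - 2 * R\<^sup>2"
      by (intro tendsto_intros R(1))
    then show "(\<lambda>n. 2 * R\<^sup>2 - 2 * (norm (p n))\<^sup>2) \<longlonglongrightarrow> 0" by simp
    fix k n :: nat assume "n \<le> k"
    then have "(norm (p k - p n))\<^sup>2 \<le> 2 * (norm (p k))\<^sup>2 + 2 * (norm (p n))\<^sup>2 - 4 * (norm (p n))\<^sup>2"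
      using p(1) D_anti by (intro mid) auto
    moreover have "(norm (p k))\<^sup>2 \<le> R\<^sup>2"
      by (intro power_mono R(2)) simp
    ultimately show "(norm (p k - p n))\<^sup>2 \<le> 2 * R\<^sup>2 - 2 * (norm (p n))\<^sup>2" by simp
  qed
  then obtain q where q: "p \<longlonglongrightarrow> q"
    using Cauchy_convergent convergent_def by blast
  have "(\<lambda>n. \<phi> (p n)) \<longlonglongrightarrow> \<phi> q"
    using cont q by (intro isCont_tendsto_compose[of _ \<phi>]) (simp_all add: continuous_on_eq_continuous_at)
  moreover have "(\<lambda>n. \<phi> m + 1 / real (Suc n)) \<longlonglongrightarrow> \<phi> m + 0"
    by (intro tendsto_intros) (use LIMSEQ_inverse_real_of_nat in \<open>simp add: inverse_eq_divide\<close>)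
  ultimately have "\<phi> q \<le> \<phi> m + 0"
    using p(1) by (intro LIMSEQ_le) (auto simp: D_def)
  \<comment> \<open>The limit \<open>q\<close> of the minimal norm points is itself a minimizer,
    which excludes a limit \<open>R\<close> below \<open>norm m\<close>.\<close>
  then have "norm m \<le> norm q"
    using minim[of q] by (intro min_norm) simp
  moreover have "norm q = R"
    using LIMSEQ_unique[OF tendsto_norm[OF q] R(1)] .
  ultimately have "R = norm m"
    using \<open>R \<le> norm m\<close> by simp
  with R(1) have "(\<lambda>n. norm (p n)) \<longlonglongrightarrow> norm m" by simp
  then have "(\<lambda>n. 4 * (norm m)\<^sup>2 - 4 * (norm (p n))\<^sup>2) \<longlonglongrightarrow> 4 * (norm m)\<^sup>2 - 4 * (norm m)\<^sup>2"
    by (rule tendsto_diff[OF tendsto_const tendsto_mult[OF tendsto_const tendsto_power]])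
  then have "\<forall>\<^sub>F n in sequentially. 4 * (norm m)\<^sup>2 - 4 * (norm (p n))\<^sup>2 < e\<^sup>2"
    using \<open>e > 0\<close> by (intro order_tendstoD(2)) auto
  then obtain n where n: "4 * (norm m)\<^sup>2 - 4 * (norm (p n))\<^sup>2 < e\<^sup>2"
    by (auto simp: eventually_sequentially)
  have "norm (w - m) < e" if w: "\<phi> w \<le> \<phi> m + 1 / Suc n" "norm w \<le> norm m" for w
  proof -
    have "(norm (w - m))\<^sup>2 \<le> 2 * (norm w)\<^sup>2 + 2 * (norm m)\<^sup>2 - 4 * (norm (p n))\<^sup>2"
      using w(1) m_in by (intro mid) (simp_all add: D_def)
    moreover have "(norm w)\<^sup>2 \<le> (norm m)\<^sup>2"
      by (intro power_mono w(2)) simp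
    ultimately have "(norm (w - m))\<^sup>2 < e\<^sup>2"
      using n by linarith
    then show ?thesis
      using \<open>e > 0\<close> by (intro power2_less_imp_less[of _ e]) simp_all
  qed
  then show ?thesis
    by (intro exI[of _ "1 / real (Suc n)"]) simp
qed

section \<open>Monotone real functions and antiderivatives on a half-line\<close>

lemma antimono_bdd_below_tendsto_at_top:
  fixes F :: "real \<Rightarrow> real"
  assumes "\<And>s t. T \<le> s \<Longrightarrow> s \<le> t \<Longrightarrow> F t \<le> F s" "\<And>t. T \<le> t \<Longrightarrow> c \<le> F t"
  shows "(F \<longlongrightarrow> Inf (F ` {T..})) at_top"
proof (rule order_tendstoI)
  have bdd: "bdd_below (F ` {T..})"
    using assms(2) by (auto intro!: bdd_belowI)
  fix a
  show "\<forall>\<^sub>F t in at_top. a < F t" if "a < Inf (F ` {T..})"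
    using eventually_ge_at_top[of T]
  proof eventually_elim
    case (elim t)
    then have "Inf (F ` {T..}) \<le> F t" by (intro cInf_lower bdd) auto
    with that show ?case by simp
  qed
  show "\<forall>\<^sub>F t in at_top. F t < a" if "Inf (F ` {T..}) < a"
  proof -
    from that obtain s where s: "s \<ge> T" "F s < a"
      using cInf_less_iff[OF _ bdd, of a] by auto
    show ?thesis
      using eventually_ge_at_top[of s]
    proof eventually_elim
      case (elim t)
      with assms(1)[OF s(1) elim] s(2) show ?case by simp
    qed
  qed
qed

text \<open>Mean value argument on the open interval, where the one-sided and two-sided derivatives
  agree. The sign is required only on \<open>{s..t}\<close>, so \<open>F\<close> may involve
  constants depending on the endpoint \<open>t\<close>.\<close>

lemma nonincreasing_within_Ici:
  fixes F :: "real \<Rightarrow> real"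
  assumes deriv: "\<And>r. r \<ge> t0 \<Longrightarrow> (F has_real_derivative F' r) (at r within {t0..})"
    and st: "t0 \<le> s" "s \<le> t" and nonpos: "\<And>r. s \<le> r \<Longrightarrow> r \<le> t \<Longrightarrow> F' r \<le> 0"
  shows "F t \<le> F s"
proof (rule DERIV_nonpos_imp_decreasing_open[OF st(2)])
  have "continuous_on {t0..} F"
    using deriv by (intro DERIV_continuous_on) auto
  then show "continuous_on {s..t} F"
    by (rule continuous_on_subset) (use st in auto)
  fix r assume r: "s < r" "r < t"
  have "at r within {t0..} = at r"
    using r st by (intro at_within_interior) auto
  then show "\<exists>y. DERIV F r :> y \<and> y \<le> 0"
    using deriv[of r] nonpos[of r] r st by auto
qed

lemma antimono_on_has_real_derivative_nonpos:
  fixes F :: "real \<Rightarrow> real"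
  assumes "antimono_on {t0..} F" "(F has_real_derivative D) (at t within {t0..})" "t \<ge> t0"
  shows "D \<le> 0"
proof (rule tendsto_upperbound)
  show "((\<lambda>s. (F s - F t) / (s - t)) \<longlongrightarrow> D) (at t within {t0..})"
    using assms(2) by (simp add: has_field_derivative_iff)
  have "(F s - F t) / (s - t) \<le> 0" if "s \<ge> t0" "s \<noteq> t" for s
    using that assms(1,3) unfolding monotone_on_def
    by (cases "s < t") (auto intro!: divide_nonneg_neg divide_nonpos_pos simp: not_less divide_le_0_iff)
  then show "\<forall>\<^sub>F s in at t within {t0..}. (F s - F t) / (s - t) \<le> 0"
    by (auto simp: eventually_at_filter)
  \<comment> \<open>The right-hand neighbourhoods alone make the filter nontrivial, also at
    \<open>t = t0\<close>.\<close>
  show "at t within {t0..} \<noteq> bot"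
  proof -
    have "at_right t \<le> at t within {t0..}"
      using assms(3) by (intro at_le) auto
    then show ?thesis
      using trivial_limit_at_right_real[of t] le_bot by metis
  qed
qed

text \<open>Integrability of \<open>e\<close> becomes a convergent antiderivative, so that later
  integral estimates reduce to comparing derivatives.\<close>

lemma convergent_antiderivative_of_nn_integral:
  fixes e :: "real \<Rightarrow> real"
  assumes cont: "continuous_on {t0..} e" and nonneg: "\<And>t. t \<ge> t0 \<Longrightarrow> e t \<ge> 0"
    and int: "(\<integral>\<^sup>+t\<in>{t0..}. ennreal (e t) \<partial>lborel) < \<infinity>"
  shows "\<exists>h H. (\<forall>t\<ge>t0. (h has_real_derivative e t) (at t within {t0..})) \<and> (h \<longlongrightarrow> H) at_top"
proof -
  define h where "h = (\<lambda>t. integral {t0..t} e)"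
  have "continuous_on {t0..t} e" for t
    using cont by (rule continuous_on_subset) auto
  then have has_int: "(e has_integral h t) {t0..t}" for t
    unfolding h_def by (intro integrable_integral integrable_continuous_real)
  have deriv: "(h has_real_derivative e t) (at t within {t0..})" if "t \<ge> t0" for t
  proof -
    \<comment> \<open>Ending the interval at \<open>t+1\<close> makes it coincide with
      \<open>{t0..}\<close> near \<open>t\<close>.\<close>
    have "(h has_real_derivative e t) (at t within {t0..t+1})"
      unfolding h_def by (intro integral_has_real_derivative) (use cont that in \<open>auto intro: continuous_on_subset\<close>)
    moreover have "at t within {t0..} = at t within {t0..t+1}"
      by (rule at_within_nhd[of _ "{..<t+1}"]) auto
    ultimately show ?thesis by simp
  qed
  define M where "M = enn2real (\<integral>\<^sup>+t\<in>{t0..}. ennreal (e t) \<partial>lborel)"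
  have "h t \<le> M" if "t \<ge> t0" for t
  proof -
    have "ennreal (h t) = (\<integral>\<^sup>+s\<in>{t0..t}. ennreal (e s) \<partial>lborel)"
      using nn_integral_has_integral_lebesgue'[OF _ has_int[of t]] nonneg by simp
    also have "\<dots> \<le> (\<integral>\<^sup>+s\<in>{t0..}. ennreal (e s) \<partial>lborel)"
      by (intro nn_integral_mono) (auto simp: indicator_def)
    also have "\<dots> = ennreal M"
      unfolding M_def using int by simp
    finally show ?thesis
      by (simp add: M_def ennreal_le_iff)
  qed
  moreover have "- h t \<le> - h s" if "t0 \<le> s" "s \<le> t" for s t
    using that deriv nonneg
    by (intro nonincreasing_within_Ici[where F = "\<lambda>t. - h t" and F' = "\<lambda>t. - e t" and ?t0.0 = t0])
       (auto intro!: derivative_eq_intros)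
  ultimately have "((\<lambda>t. - h t) \<longlongrightarrow> Inf ((\<lambda>t. - h t) ` {t0..})) at_top"
    by (intro antimono_bdd_below_tendsto_at_top[of t0 _ "- M"]) auto
  then have "(h \<longlongrightarrow> - Inf ((\<lambda>t. - h t) ` {t0..})) at_top"
    using tendsto_minus_cancel_left by fastforce
  with deriv show ?thesis by blast
qed

lemma has_real_derivative_inner_self:
  fixes z :: "real \<Rightarrow> 'z::real_inner"
  assumes "(z has_vector_derivative z') (at t within S)"
  shows "((\<lambda>t. z t \<bullet> z t) has_real_derivative 2 * (z t \<bullet> z')) (at t within S)"
  using has_derivative_inner[OF assms[unfolded has_vector_derivative_def] assms[unfolded has_vector_derivative_def]]
  unfolding has_field_derivative_def
  by (rule has_derivative_eq_rhs) (simp add: fun_eq_iff inner_commute)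

section \<open>Energy estimates for the regularized flow\<close>

text \<open>The flow on the product space. The primal equation is tested against an arbitrary
  \<open>w\<close>, which hides adjoints and gradients; \<open>d\<phi>\<close> already contains the
  contribution of \<open>ls\<close>, whence the coefficient \<open>l t - ls\<close>. The function
  \<open>h\<close> encodes the integrability of \<open>\<epsilon>\<close>.\<close>

locale regularized_primal_dual_flow =
  fixes \<phi> :: "'h::{real_inner, complete_space} \<Rightarrow> real" and d\<phi> :: "'h \<Rightarrow> 'h \<Rightarrow> real"
    and K :: "'h \<Rightarrow> 'c::real_inner" and b ls :: 'c and us :: 'h
    and t0 \<gamma> \<delta> H :: real and \<beta> \<beta>' \<epsilon> \<epsilon>' h :: "real \<Rightarrow> real"
    and u u' u'' :: "real \<Rightarrow> 'h" and l l' :: "real \<Rightarrow> 'c"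
  assumes convex: "convex_on UNIV \<phi>"
    and deriv: "\<And>w. (\<phi> has_derivative d\<phi> w) (at w)"
    and K: "bounded_linear K" and K_us: "K us = b"
    and us_min: "\<And>w. \<phi> us \<le> \<phi> w" and us_min_norm: "\<And>w. \<phi> w = \<phi> us \<Longrightarrow> norm us \<le> norm w"
    and \<delta>_pos: "\<delta> > 0" and \<gamma>\<delta>: "1 / \<delta> \<le> \<gamma>"
    and \<beta>_pos: "\<And>t. t \<ge> t0 \<Longrightarrow> \<beta> t > 0" and \<beta>_mono: "mono_on {t0..} \<beta>"
    and \<beta>_deriv: "\<And>t. t \<ge> t0 \<Longrightarrow> (\<beta> has_real_derivative \<beta>' t) (at t within {t0..})"
    and \<beta>'_le: "\<And>t. t \<ge> t0 \<Longrightarrow> \<beta>' t \<le> 1 / \<delta> * \<beta> t"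
    and \<epsilon>_nonneg: "\<And>t. t \<ge> t0 \<Longrightarrow> \<epsilon> t \<ge> 0"
    and \<epsilon>_deriv: "\<And>t. t \<ge> t0 \<Longrightarrow> (\<epsilon> has_real_derivative \<epsilon>' t) (at t within {t0..})"
    and \<epsilon>'_nonpos: "\<And>t. t \<ge> t0 \<Longrightarrow> \<epsilon>' t \<le> 0"
    and \<epsilon>_lim: "(\<epsilon> \<longlongrightarrow> 0) at_top"
    and h_deriv: "\<And>t. t \<ge> t0 \<Longrightarrow> (h has_real_derivative \<epsilon> t) (at t within {t0..})"
    and h_lim: "(h \<longlongrightarrow> H) at_top"
    and \<beta>\<epsilon>_lim: "filterlim (\<lambda>t. \<beta> t * \<epsilon> t) at_top at_top"
    and u_deriv: "\<And>t. t \<ge> t0 \<Longrightarrow> (u has_vector_derivative u' t) (at t within {t0..})"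
    and u'_deriv: "\<And>t. t \<ge> t0 \<Longrightarrow> (u' has_vector_derivative u'' t) (at t within {t0..})"
    and l_deriv: "\<And>t. t \<ge> t0 \<Longrightarrow> (l has_vector_derivative l' t) (at t within {t0..})"
    and primal: "\<And>t w. t \<ge> t0 \<Longrightarrow> u'' t \<bullet> w + \<gamma> * (u' t \<bullet> w) +
      \<beta> t * (d\<phi> (u t) w + (l t - ls) \<bullet> K w + \<epsilon> t * (u t \<bullet> w)) = 0"
    and dual: "\<And>t. t \<ge> t0 \<Longrightarrow> l' t = \<beta> t *\<^sub>R (K (u t + \<delta> *\<^sub>R u' t) - b)"
begin

text \<open>By \<open>K us = b\<close>, the dual equation reads
  \<open>l' t = \<beta> t *\<^sub>R K (v t)\<close>. This makes \<open>v t\<close> the right test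
  vector for the primal equation.\<close>

definition v :: "real \<Rightarrow> 'h" where
  "v t = u t - us + \<delta> *\<^sub>R u' t"

definition energy :: "real \<Rightarrow> real \<Rightarrow> real" where
  "energy c t = \<delta>\<^sup>2 * (\<beta> t * (\<phi> (u t) - \<phi> us + \<epsilon> t / 2 * (u t \<bullet> u t - c))) + (v t \<bullet> v t) / 2
     + (\<delta> * \<gamma> - 1) / 2 * ((u t - us) \<bullet> (u t - us)) + \<delta> / 2 * ((l t - ls) \<bullet> (l t - ls))"

text \<open>The derivative given by the product rule alone; the flow equations enter in
  \<open>energy'_le\<close>.\<close>

definition energy' :: "real \<Rightarrow> real \<Rightarrow> real" where
  "energy' c t = \<delta>\<^sup>2 * (\<beta>' t * (\<phi> (u t) - \<phi> us + \<epsilon> t / 2 * (u t \<bullet> u t - c))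
     + \<beta> t * (d\<phi> (u t) (u' t) + \<epsilon>' t / 2 * (u t \<bullet> u t - c) + \<epsilon> t * (u t \<bullet> u' t)))
     + (v t \<bullet> (u' t + \<delta> *\<^sub>R u'' t))
     + (\<delta> * \<gamma> - 1) * ((u t - us) \<bullet> u' t) + \<delta> * ((l t - ls) \<bullet> l' t)"

lemma v_deriv:
  assumes "t \<ge> t0"
  shows "(v has_vector_derivative u' t + \<delta> *\<^sub>R u'' t) (at t within {t0..})"
proof -
  have "((\<lambda>t. u t - us + \<delta> *\<^sub>R u' t) has_vector_derivative u' t - 0 + \<delta> *\<^sub>R u'' t) (at t within {t0..})"
    by (intro has_vector_derivative_add has_vector_derivative_diff has_vector_derivative_const
        bounded_linear.has_vector_derivative[OF bounded_linear_scaleR_right] u_deriv u'_deriv assms)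
  then show ?thesis by (simp add: v_def[abs_def])
qed

lemma \<phi>_u_deriv:
  assumes "t \<ge> t0"
  shows "((\<lambda>t. \<phi> (u t)) has_real_derivative d\<phi> (u t) (u' t)) (at t within {t0..})"
proof -
  have "((\<lambda>t. \<phi> (u t)) has_derivative (\<lambda>s. d\<phi> (u t) (s *\<^sub>R u' t))) (at t within {t0..})"
    using u_deriv[OF assms] deriv unfolding has_vector_derivative_def by (rule has_derivative_compose)
  moreover have "(\<lambda>s. d\<phi> (u t) (s *\<^sub>R u' t)) = (*) (d\<phi> (u t) (u' t))"
    using linear_scale[OF has_derivative_linear[OF deriv]] by (simp add: fun_eq_iff mult.commute)
  ultimately show ?thesis by (simp add: has_field_derivative_def)
qed

lemma diff_us_deriv:
  assumes "t \<ge> t0"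
  shows "((\<lambda>t. u t - us) has_vector_derivative u' t) (at t within {t0..})"
  using has_vector_derivative_diff[OF u_deriv[OF assms] has_vector_derivative_const[of us]] by simp

lemma energy_deriv:
  assumes "t \<ge> t0"
  shows "(energy c has_real_derivative energy' c t) (at t within {t0..})"
proof -
  have l_diff: "((\<lambda>t. l t - ls) has_vector_derivative l' t) (at t within {t0..})"
    using has_vector_derivative_diff[OF l_deriv[OF assms] has_vector_derivative_const[of ls]] by simp
  note facts = \<beta>_deriv[OF assms] \<epsilon>_deriv[OF assms] \<phi>_u_deriv[OF assms]
    has_real_derivative_inner_self[OF u_deriv[OF assms]]
    has_real_derivative_inner_self[OF v_deriv[OF assms]]
    has_real_derivative_inner_self[OF diff_us_deriv[OF assms]]
    has_real_derivative_inner_self[OF l_diff]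
  show ?thesis
    unfolding energy_def[abs_def] energy'_def
    by (rule DERIV_cong, (rule facts DERIV_const DERIV_cmult DERIV_cdivide DERIV_add DERIV_diff DERIV_mult')+)
      (simp add: field_simps)
qed

text \<open>Testing the primal equation with \<open>v t\<close> cancels the multiplier terms, the
  terms in \<open>d\<phi> (u t) (u' t)\<close> and those in \<open>u t \<bullet> u' t\<close>; the
  weight \<open>\<delta> * \<gamma> - 1\<close> in the energy cancels
  \<open>(u t - us) \<bullet> u' t\<close>. Convexity bounds what is left.\<close>

lemma energy'_le:
  assumes "t \<ge> t0"
  shows "energy' c t \<le> \<delta> * (\<delta> * \<beta>' t - \<beta> t) * (\<phi> (u t) - \<phi> us + \<epsilon> t / 2 * (u t \<bullet> u t - c))
     + \<delta>\<^sup>2 * \<beta> t * \<epsilon>' t / 2 * (u t \<bullet> u t - c) + \<delta> / 2 * (\<beta> t * \<epsilon> t) * (us \<bullet> us - c)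
     - \<delta> / 2 * (\<beta> t * \<epsilon> t) * ((u t - us) \<bullet> (u t - us))"
    (is "_ \<le> ?rhs")
proof -
  interpret d: linear "d\<phi> (u t)"
    using has_derivative_linear[OF deriv] .
  interpret K: bounded_linear K by (rule K)
  define p where "p = d\<phi> (u t) (u t - us)"
  define q where "q = d\<phi> (u t) (u' t)"
  define z where "z = u t - us"
  define m where "m = (l t - ls) \<bullet> K (v t)"
  have dv: "d\<phi> (u t) (v t) = p + \<delta> * q"
    by (simp add: v_def d.add d.scale p_def q_def)
  have Kv: "K (v t) = K (u t + \<delta> *\<^sub>R u' t) - b"
    by (simp add: v_def K.add K.diff K_us)
  have vu': "v t \<bullet> u' t = z \<bullet> u' t + \<delta> * (u' t \<bullet> u' t)"
    by (simp add: v_def z_def inner_add_left)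
  have uv: "u t \<bullet> v t = u t \<bullet> z + \<delta> * (u t \<bullet> u' t)"
    by (simp add: v_def z_def inner_add_right)
  \<comment> \<open>Polarization splits the regularization term into the distance to
    \<open>us\<close> and the difference of squared norms.\<close>
  have uz: "u t \<bullet> z = (u t \<bullet> u t + z \<bullet> z - us \<bullet> us) / 2"
    by (simp add: z_def inner_diff_left inner_diff_right inner_commute field_simps)
  have ll: "(l t - ls) \<bullet> l' t = \<beta> t * m"
    by (simp add: dual[OF assms] Kv m_def)
  have "u'' t \<bullet> v t = - \<gamma> * (v t \<bullet> u' t) - \<beta> t * (p + \<delta> * q + m + \<epsilon> t * (u t \<bullet> v t))"
    using primal[OF assms, of "v t"] by (simp add: dv m_def inner_commute algebra_simps)
  then have vu'': "v t \<bullet> (u' t + \<delta> *\<^sub>R u'' t) =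
      v t \<bullet> u' t + \<delta> * (- \<gamma> * (v t \<bullet> u' t) - \<beta> t * (p + \<delta> * q + m + \<epsilon> t * (u t \<bullet> v t)))"
    by (simp add: inner_add_right inner_commute[of "v t" "u'' t"])
  have eq: "energy' c t = \<delta>\<^sup>2 * \<beta>' t * (\<phi> (u t) - \<phi> us + \<epsilon> t / 2 * (u t \<bullet> u t - c))
     + \<delta>\<^sup>2 * \<beta> t * \<epsilon>' t / 2 * (u t \<bullet> u t - c)
     - \<delta> * \<beta> t * p - \<delta> * \<beta> t * \<epsilon> t * ((u t \<bullet> u t + z \<bullet> z - us \<bullet> us) / 2)
     - \<delta> * (\<delta> * \<gamma> - 1) * (u' t \<bullet> u' t)"
    unfolding energy'_def vu'' vu' uv uz ll z_def[symmetric] q_def[symmetric]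
    by (simp add: field_simps power2_eq_square)
  have "\<phi> (u t) - \<phi> us \<le> p"
  proof -
    have "d\<phi> (u t) (us - u t) = - p"
      unfolding p_def using d.neg[of "u t - us"] by simp
    with convex_on_above_tangent[OF convex deriv, of "u t" us] show ?thesis by simp
  qed
  then have "\<delta> * \<beta> t * (\<phi> (u t) - \<phi> us) \<le> \<delta> * \<beta> t * p"
    using \<delta>_pos \<beta>_pos[OF assms] by (intro mult_left_mono) simp_all
  moreover have "0 \<le> \<delta> * (\<delta> * \<gamma> - 1) * (u' t \<bullet> u' t)"
    using \<delta>_pos \<gamma>\<delta> by (intro mult_nonneg_nonneg) (simp_all add: field_simps)
  \<comment> \<open>The slack consists of the tangent inequality at \<open>u t\<close> and the
    damping term, both nonnegative.\<close>
  moreover have "?rhs = energy' c t + (\<delta> * \<beta> t * p - \<delta> * \<beta> t * (\<phi> (u t) - \<phi> us))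
      + \<delta> * (\<delta> * \<gamma> - 1) * (u' t \<bullet> u' t)"
    unfolding eq z_def[symmetric] by (simp add: field_simps power2_eq_square)
  ultimately show ?thesis by linarith
qed

text \<open>Two parts are kept: the gap gives convergence of the values, and
  \<open>v t \<bullet> v t\<close> bounds the growth of the distance to \<open>us\<close>.\<close>

lemma energy_lower:
  assumes "t \<ge> t0" "c \<le> u t \<bullet> u t"
  shows "\<delta>\<^sup>2 * (\<beta> t * (\<phi> (u t) - \<phi> us)) + (v t \<bullet> v t) / 2 \<le> energy c t"
proof -
  have "0 \<le> \<delta>\<^sup>2 * (\<beta> t * (\<epsilon> t / 2 * (u t \<bullet> u t - c)))"
    using assms \<beta>_pos[of t] \<epsilon>_nonneg[of t] by (intro mult_nonneg_nonneg) simp_all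
  moreover have "0 \<le> (\<delta> * \<gamma> - 1) / 2 * ((u t - us) \<bullet> (u t - us))"
    using \<delta>_pos \<gamma>\<delta> by (intro mult_nonneg_nonneg) (simp_all add: field_simps)
  moreover have "0 \<le> \<delta> / 2 * ((l t - ls) \<bullet> (l t - ls))"
    using \<delta>_pos by (intro mult_nonneg_nonneg) simp_all
  ultimately show ?thesis
    unfolding energy_def by (simp add: distrib_left)
qed

lemma gap_nonneg:
  assumes "t \<ge> t0" "c \<le> u t \<bullet> u t"
  shows "0 \<le> \<phi> (u t) - \<phi> us + \<epsilon> t / 2 * (u t \<bullet> u t - c)"
  using assms us_min[of "u t"] \<epsilon>_nonneg[of t] by (intro add_nonneg_nonneg mult_nonneg_nonneg) simp_all

text \<open>The growth condition on \<open>\<beta>\<close> and the monotonicity of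
  \<open>\<epsilon>\<close> make the first two terms of \<open>energy'_le\<close>
  nonpositive.\<close>

lemma energy'_le_of_norm_ge:
  assumes "t \<ge> t0" "c \<le> u t \<bullet> u t"
  shows "energy' c t \<le> \<delta> / 2 * (\<beta> t * \<epsilon> t) * (us \<bullet> us - c)
     - \<delta> / 2 * (\<beta> t * \<epsilon> t) * ((u t - us) \<bullet> (u t - us))"
proof -
  have "\<delta> * (\<delta> * \<beta>' t - \<beta> t) * (\<phi> (u t) - \<phi> us + \<epsilon> t / 2 * (u t \<bullet> u t - c)) \<le> 0"
    using \<delta>_pos \<beta>'_le[OF assms(1)]
    by (intro mult_nonpos_nonneg mult_nonneg_nonpos gap_nonneg assms) (simp_all add: field_simps)
  moreover have "\<delta>\<^sup>2 * \<beta> t * \<epsilon>' t / 2 * (u t \<bullet> u t - c) \<le> 0"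
    using assms \<beta>_pos[OF assms(1)] \<epsilon>'_nonpos[OF assms(1)]
    by (intro mult_nonpos_nonneg) (simp_all add: mult_nonneg_nonpos)
  ultimately show ?thesis
    using energy'_le[OF assms(1), of c] by linarith
qed

section \<open>Convergence of the values of \<open>\<phi>\<close> along the trajectory\<close>

lemma \<beta>_at_top: "filterlim \<beta> at_top at_top"
proof (rule filterlim_at_top_mono[OF \<beta>\<epsilon>_lim])
  have "\<forall>\<^sub>F t in at_top. \<epsilon> t < 1"
    using \<epsilon>_lim by (rule order_tendstoD) simp
  then show "\<forall>\<^sub>F t in at_top. \<beta> t * \<epsilon> t \<le> \<beta> t"
    using eventually_ge_at_top[of t0]
  proof eventually_elim
    case (elim t)
    then show ?case using \<beta>_pos[of t] by (simp add: mult_le_cancel_left1)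
  qed
qed

lemma energy_increment_le:
  assumes "t0 \<le> s" "s \<le> t"
  shows "energy 0 t \<le> energy 0 s + \<delta> / 2 * (us \<bullet> us) * \<beta> t * (h t - h s)"
proof -
  \<comment> \<open>The value of \<open>\<beta>\<close> is frozen at the right endpoint, where it is
    largest on \<open>{s..t}\<close>, so \<open>?k\<close> is constant in \<open>r\<close>.\<close>
  let ?k = "\<delta> / 2 * (us \<bullet> us) * \<beta> t"
  have "energy 0 t - ?k * h t \<le> energy 0 s - ?k * h s"
  proof (rule nonincreasing_within_Ici[OF _ assms])
    fix r assume "r \<ge> t0"
    then show "((\<lambda>r. energy 0 r - ?k * h r) has_real_derivative energy' 0 r - ?k * \<epsilon> r) (at r within {t0..})"
      by (intro DERIV_diff DERIV_cmult energy_deriv h_deriv)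
  next
    fix r assume r: "s \<le> r" "r \<le> t"
    then have "r \<ge> t0" using assms by simp
    have "\<beta> r \<le> \<beta> t"
      using \<beta>_mono r assms by (auto simp: monotone_on_def)
    then have "\<delta> / 2 * (us \<bullet> us) * (\<beta> r * \<epsilon> r) \<le> \<delta> / 2 * (us \<bullet> us) * (\<beta> t * \<epsilon> r)"
      using \<delta>_pos \<epsilon>_nonneg[OF \<open>r \<ge> t0\<close>] by (intro mult_left_mono mult_right_mono) simp_all
    moreover have "0 \<le> \<delta> / 2 * (\<beta> r * \<epsilon> r) * ((u r - us) \<bullet> (u r - us))"
      using \<delta>_pos \<epsilon>_nonneg[OF \<open>r \<ge> t0\<close>] \<beta>_pos[OF \<open>r \<ge> t0\<close>] by (intro mult_nonneg_nonneg) simp_all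
    moreover have "energy' 0 r \<le> \<delta> / 2 * (\<beta> r * \<epsilon> r) * (us \<bullet> us - 0)
        - \<delta> / 2 * (\<beta> r * \<epsilon> r) * ((u r - us) \<bullet> (u r - us))"
      by (rule energy'_le_of_norm_ge[OF \<open>r \<ge> t0\<close>]) simp
    ultimately show "energy' 0 r - ?k * \<epsilon> r \<le> 0"
      by (simp add: mult_ac)
  qed
  then show ?thesis by (simp add: right_diff_distrib)
qed

text \<open>A Kronecker-type argument: since \<open>\<beta>\<close> is monotone and unbounded, integrability of \<open>\<epsilon>\<close>
  makes the integral of \<open>\<beta> \<epsilon>\<close> over \<open>{t0..t}\<close> negligible against \<open>\<beta> t\<close>.\<close>

lemma \<phi>_u_tendsto: "((\<lambda>t. \<phi> (u t)) \<longlongrightarrow> \<phi> us) at_top"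
proof (rule order_tendstoI)
  show "\<forall>\<^sub>F t in at_top. a < \<phi> (u t)" if "a < \<phi> us" for a
    using that us_min by (intro always_eventually) (auto intro: less_le_trans)
next
  fix a assume a: "\<phi> us < a"
  define k where "k = \<delta> / 2 * (us \<bullet> us)"
  \<comment> \<open>Half of the target: the energy at \<open>s\<close> and the integral of
    \<open>\<epsilon>\<close> after \<open>s\<close> may each contribute
    \<open>\<beta> t * e\<close>.\<close>
  define e where "e = \<delta>\<^sup>2 * (a - \<phi> us) / 2"
  have e: "e > 0" using a \<delta>_pos by (simp add: e_def)
  have k: "k \<ge> 0" using \<delta>_pos by (simp add: k_def)
  have kh: "((\<lambda>t. k * h t) \<longlongrightarrow> k * H) at_top"
    by (intro tendsto_intros h_lim)
  then have "\<forall>\<^sub>F s in at_top. dist (k * h s) (k * H) < e/2"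
    using e by (intro tendstoD) simp_all
  then obtain s where s: "s \<ge> t0" "\<And>t. t \<ge> s \<Longrightarrow> dist (k * h t) (k * H) < e/2"
    unfolding eventually_at_top_linorder by (metis linorder_le_cases order_trans)
  have "\<forall>\<^sub>F t in at_top. energy 0 s / e < \<beta> t"
    using \<beta>_at_top by (simp add: filterlim_at_top_dense)
  then show "\<forall>\<^sub>F t in at_top. \<phi> (u t) < a"
    using eventually_ge_at_top[of s]
  proof eventually_elim
    case (elim t)
    then have t: "t \<ge> t0" using s(1) by simp
    note b = \<beta>_pos[OF t]
    have "k * h t - k * h s < e"
      using s(2)[of t] s(2)[of s] elim by (simp add: dist_real_def abs_if split: if_splits)
    then have "\<beta> t * (k * h t - k * h s) \<le> \<beta> t * e"
      using b by (intro mult_left_mono) simp_all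
    moreover have "energy 0 s < \<beta> t * e"
      using elim e by (simp add: field_simps)
    moreover have "energy 0 t \<le> energy 0 s + \<beta> t * (k * h t - k * h s)"
      using energy_increment_le[OF s(1) elim(2)] by (simp add: k_def algebra_simps diff_divide_distrib)
    moreover have "\<delta>\<^sup>2 * (\<beta> t * (\<phi> (u t) - \<phi> us)) + (v t \<bullet> v t) / 2 \<le> energy 0 t"
      by (rule energy_lower[OF t]) simp
    moreover have "(v t \<bullet> v t) / 2 \<ge> 0" by simp
    ultimately have "\<delta>\<^sup>2 * (\<beta> t * (\<phi> (u t) - \<phi> us)) < \<beta> t * e + \<beta> t * e" by linarith
    also have "\<dots> = \<delta>\<^sup>2 * (\<beta> t * (a - \<phi> us))"
      by (simp add: e_def)
    finally show ?case
      using b \<delta>_pos by (simp add: mult_less_cancel_left_pos)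
  qed
qed

section \<open>Strong convergence inside and outside the ball\<close>

lemma eventually_close_if_in_ball:
  assumes "e > 0"
  shows "\<forall>\<^sub>F t in at_top. norm (u t) \<le> norm us \<longrightarrow> norm (u t - us) < e"
proof -
  have "continuous_on UNIV \<phi>"
    using deriv by (intro continuous_at_imp_continuous_on) (blast intro: has_derivative_continuous)
  from min_norm_minimizer_well_posed[OF convex this us_min us_min_norm assms]
  obtain d where d: "d > 0" "\<And>w. \<phi> w \<le> \<phi> us + d \<Longrightarrow> norm w \<le> norm us \<Longrightarrow> norm (w - us) < e"
    by blast
  have "\<forall>\<^sub>F t in at_top. \<phi> (u t) < \<phi> us + d"
    using \<phi>_u_tendsto d(1) by (intro order_tendstoD(2)) auto
  then show ?thesis
    by eventually_elim (use d(2) in \<open>auto intro: less_imp_le\<close>)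
qed

text \<open>The left side is the derivative of the squared distance to \<open>us\<close>. Expanding
  \<open>v t \<bullet> v t\<close> bounds it from above, with no separate bound on
  \<open>u' t\<close>.\<close>

lemma diff_us_inner_u':
  "2 * ((u t - us) \<bullet> u' t) \<le> (v t \<bullet> v t) / \<delta>"
proof -
  define z where "z = u t - us"
  have "\<delta> * (2 * (z \<bullet> u' t)) = v t \<bullet> v t - z \<bullet> z - \<delta>\<^sup>2 * (u' t \<bullet> u' t)"
    unfolding v_def z_def[symmetric]
    by (simp add: inner_add_left inner_add_right inner_commute power2_eq_square algebra_simps)
  also have "\<dots> \<le> v t \<bullet> v t"
    using inner_ge_zero[of z] mult_nonneg_nonneg[OF zero_le_power2[of \<delta>] inner_ge_zero[of "u' t"]]
    by linarith
  finally show ?thesis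
    using \<delta>_pos by (simp add: z_def field_simps)
qed

lemma tendsto_of_outside_ball:
  assumes outside: "\<forall>\<^sub>F t in at_top. norm us < norm (u t)"
  shows "((\<lambda>t. norm (u t - us)) \<longlongrightarrow> 0) at_top"
proof -
  \<comment> \<open>This \<open>c\<close> removes the positive term of
    \<open>energy'_le_of_norm_ge\<close>, and outside the ball it satisfies
    \<open>c \<le> u t \<bullet> u t\<close>.\<close>
  define c where "c = us \<bullet> us"
  define w where "w = (\<lambda>t. (u t - us) \<bullet> (u t - us))"
  have "\<forall>\<^sub>F t in at_top. norm us < norm (u t) \<and> 1 \<le> \<beta> t * \<epsilon> t \<and> t0 \<le> t"
    using outside \<beta>\<epsilon>_lim by (intro eventually_conj eventually_ge_at_top) (simp_all add: filterlim_at_top)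
  then obtain T where T: "\<And>t. t \<ge> T \<Longrightarrow> norm us < norm (u t)"
    "\<And>t. t \<ge> T \<Longrightarrow> 1 \<le> \<beta> t * \<epsilon> t" "\<And>t. t \<ge> T \<Longrightarrow> t0 \<le> t"
    by (auto simp: eventually_at_top_linorder)
  have c_le: "c \<le> u t \<bullet> u t" if "t \<ge> T" for t
    using T(1)[OF that] by (simp add: c_def norm_lt)
  have w0: "w t \<ge> 0" for t by (simp add: w_def)
  have E'_le: "energy' c t \<le> - (\<delta> / 2 * w t)" if "t \<ge> T" for t
  proof -
    have "energy' c t \<le> - (\<delta> / 2 * (\<beta> t * \<epsilon> t) * w t)"
      using energy'_le_of_norm_ge[OF T(3)[OF that] c_le[OF that]] by (simp add: c_def w_def)
    moreover have "\<delta> / 2 * 1 * w t \<le> \<delta> / 2 * (\<beta> t * \<epsilon> t) * w t"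
      using T(2)[OF that] \<delta>_pos w0 by (intro mult_right_mono mult_left_mono) simp_all
    ultimately show ?thesis by simp
  qed
  have "0 \<le> \<delta>\<^sup>2 * (\<beta> t * (\<phi> (u t) - \<phi> us))" if "t \<ge> T" for t
    using \<beta>_pos[OF T(3)[OF that]] us_min[of "u t"] by (intro mult_nonneg_nonneg) simp_all
  with energy_lower[OF T(3) c_le] have v_le: "v t \<bullet> v t \<le> 2 * energy c t" if "t \<ge> T" for t
    using that by fastforce
  have E_nonneg: "0 \<le> energy c t" if "t \<ge> T" for t
    using v_le[OF that] inner_ge_zero[of "v t"] by linarith
  have E_mono: "energy c t \<le> energy c s" if "T \<le> s" "s \<le> t" for s t
  proof (rule nonincreasing_within_Ici[OF energy_deriv T(3)[OF that(1)] that(2)])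
    fix r assume "s \<le> r"
    then have "T \<le> r" using that by simp
    have "0 \<le> \<delta> / 2 * w r" using w0[of r] \<delta>_pos by simp
    with E'_le[OF \<open>T \<le> r\<close>] show "energy' c r \<le> 0" by linarith
  qed
  then obtain L where L: "(energy c \<longlongrightarrow> L) at_top"
    using antimono_bdd_below_tendsto_at_top[of T "energy c" 0] E_nonneg by blast
  \<comment> \<open>An upper bound for the derivative of \<open>w\<close> after \<open>T\<close>, by
    \<open>diff_us_inner_u'\<close> and the decrease of the energy.\<close>
  define V where "V = 2 * energy c T / \<delta>"
  have V0: "V \<ge> 0" using E_nonneg[of T] \<delta>_pos by (simp add: V_def)
  \<comment> \<open>Squaring \<open>w\<close> turns the bound \<open>V\<close> on its derivative
    into \<open>2 * V * w\<close>, and \<open>4 * V / \<delta>\<close> times the energy decreases at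
    least at this rate.\<close>
  define P where "P = (\<lambda>t. w t * w t + 4 * V / \<delta> * energy c t)"
  have w_deriv: "(w has_real_derivative 2 * ((u t - us) \<bullet> u' t)) (at t within {t0..})" if "t \<ge> t0" for t
    unfolding w_def using diff_us_deriv[OF that] by (rule has_real_derivative_inner_self)
  have P_mono: "P t \<le> P s" if "T \<le> s" "s \<le> t" for s t
  proof (rule nonincreasing_within_Ici[OF _ T(3)[OF that(1)] that(2)])
    fix r assume "r \<ge> t0"
    then show "(P has_real_derivative w r * (2 * ((u r - us) \<bullet> u' r)) + 2 * ((u r - us) \<bullet> u' r) * w r
        + 4 * V / \<delta> * energy' c r) (at r within {t0..})"
      unfolding P_def by (intro DERIV_add DERIV_mult' DERIV_cmult w_deriv energy_deriv)
  next
    fix r assume "s \<le> r"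
    then have r: "T \<le> r" using that by simp
    have "v r \<bullet> v r \<le> 2 * energy c T"
      using v_le[OF r] E_mono[OF order_refl r] by simp
    then have "2 * ((u r - us) \<bullet> u' r) \<le> V"
      using diff_us_inner_u'[of r] \<delta>_pos unfolding V_def
      by (meson divide_right_mono less_imp_le order_trans)
    then have "2 * ((u r - us) \<bullet> u' r) * w r \<le> V * w r"
      using w0 by (rule mult_right_mono)
    moreover have "4 * V / \<delta> * energy' c r \<le> 4 * V / \<delta> * - (\<delta> / 2 * w r)"
      using V0 \<delta>_pos by (intro mult_left_mono E'_le r) simp
    moreover have "4 * V / \<delta> * - (\<delta> / 2 * w r) = - 2 * (V * w r)"
      using \<delta>_pos by simp
    ultimately show "w r * (2 * ((u r - us) \<bullet> u' r)) + 2 * ((u r - us) \<bullet> u' r) * w r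
        + 4 * V / \<delta> * energy' c r \<le> 0"
      by (simp add: mult.commute[of "w r"])
  qed
  have "0 \<le> P t" if "t \<ge> T" for t
    unfolding P_def using V0 \<delta>_pos E_nonneg[OF that] by simp
  then obtain L' where L': "(P \<longlongrightarrow> L') at_top"
    using antimono_bdd_below_tendsto_at_top[of T P 0] P_mono by blast
  define W where "W = L' - 4 * V / \<delta> * L"
  have "((\<lambda>t. P t - 4 * V / \<delta> * energy c t) \<longlongrightarrow> W) at_top"
    unfolding W_def by (intro tendsto_intros L L')
  then have ww: "((\<lambda>t. w t * w t) \<longlongrightarrow> W) at_top"
    by (simp add: P_def)
  have "W \<le> 0"
  \<comment> \<open>A positive limit would keep \<open>w\<close> above some \<open>a > 0\<close>, so
    the energy would fall at least linearly and become negative.\<close>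
  proof (rule ccontr)
    assume "\<not> W \<le> 0"
    then have W: "0 < W / 2" "W / 2 < W" by simp_all
    define a where "a = sqrt (W / 2)"
    have a: "a > 0" using W by (simp add: a_def)
    have "\<forall>\<^sub>F t in at_top. W / 2 < w t * w t \<and> T \<le> t"
      by (intro eventually_conj eventually_ge_at_top order_tendstoD(1)[OF ww W(2)])
    then obtain S where S: "\<And>t. t \<ge> S \<Longrightarrow> W / 2 < w t * w t" "\<And>t. t \<ge> S \<Longrightarrow> T \<le> t"
      by (auto simp: eventually_at_top_linorder)
    have w_ge: "a \<le> w t" if "t \<ge> S" for t
      unfolding a_def using S(1)[OF that] w0 by (intro real_le_lsqrt) (simp_all add: power2_eq_square)
    define r where "r = \<delta> / 2 * a"
    have r: "r > 0" using a \<delta>_pos by (simp add: r_def)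
    \<comment> \<open>Late enough for decrease at rate \<open>r\<close> to bring the energy down to
      at most -1.\<close>
    define t where "t = S + (energy c S + 1) / r"
    have t: "S \<le> t" using r E_nonneg[OF S(2)[OF order_refl]] by (simp add: t_def)
    have "energy c t + r * t \<le> energy c S + r * S"
    proof (rule nonincreasing_within_Ici[OF _ T(3)[OF S(2)[OF order_refl]] t])
      fix s assume "s \<ge> t0"
      then show "((\<lambda>t. energy c t + r * t) has_real_derivative energy' c s + r * 1) (at s within {t0..})"
        by (intro DERIV_add DERIV_cmult DERIV_ident energy_deriv)
    next
      fix s assume s: "S \<le> s"
      have "r \<le> \<delta> / 2 * w s"
        unfolding r_def using w_ge[OF s] \<delta>_pos by (intro mult_left_mono) simp_all
      with E'_le[OF S(2)[OF s]] show "energy' c s + r * 1 \<le> 0" by simp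
    qed
    moreover have "r * t = r * S + energy c S + 1"
      using r by (simp add: t_def field_simps)
    ultimately show False
      using E_nonneg[OF S(2)[OF t]] by simp
  qed
  moreover have "W \<ge> 0"
    using ww by (rule tendsto_lowerbound) simp_all
  ultimately have "((\<lambda>t. w t * w t) \<longlongrightarrow> 0) at_top"
    using ww by simp
  \<comment> \<open>The inner root recovers \<open>w\<close>, the outer one the norm.\<close>
  then have "((\<lambda>t. sqrt (sqrt (w t * w t))) \<longlongrightarrow> sqrt (sqrt 0)) at_top"
    by (intro tendsto_real_sqrt)
  then show ?thesis
    using w0 by (simp add: w_def norm_eq_sqrt_inner)
qed

text \<open>Either the trajectory is eventually outside the ball and converges, or it is in the ball
  at arbitrarily late times, where it is eventually close.\<close>

lemma frequently_close:
  assumes "e > 0"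
  shows "\<exists>\<^sub>F t in at_top. norm (u t - us) < e"
proof (cases "\<forall>\<^sub>F t in at_top. norm us < norm (u t)")
  case True
  from order_tendstoD(2)[OF tendsto_of_outside_ball[OF this] assms] show ?thesis
    by (rule eventually_frequently[rotated]) simp
next
  case False
  then have "\<exists>\<^sub>F t in at_top. norm (u t) \<le> norm us"
    by (simp add: not_eventually not_less)
  from frequently_eventually_frequently[OF this eventually_close_if_in_ball[OF assms]]
  show ?thesis by (rule frequently_elim1) simp
qed

end

section \<open>The augmented Lagrangian\<close>

lemma norm_sq_convex_combination:
  fixes p q :: "'c::real_inner"
  assumes "s + t = (1::real)"
  shows "(norm (s *\<^sub>R p + t *\<^sub>R q))\<^sup>2 = s * (norm p)\<^sup>2 + t * (norm q)\<^sup>2 - s * t * (norm (p - q))\<^sup>2"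
proof -
  have t: "t = 1 - s" using assms by simp
  show ?thesis
    unfolding power2_norm_eq_inner t
    by (simp add: inner_add_left inner_add_right inner_diff_left inner_diff_right inner_commute algebra_simps)
qed

text \<open>The penalty adds strong convexity in the value of \<open>A x + B y\<close>. Dropping the
  last term gives convexity; keeping it forces minimizers to share that value.\<close>

lemma aug_lagrangian_convex_combination:
  fixes A :: "'a::real_inner \<Rightarrow> 'c::real_inner" and B :: "'b::real_inner \<Rightarrow> 'c"
  assumes "linear A" "linear B" "convex_on UNIV f" "convex_on UNIV g" "0 \<le> s" "0 \<le> t" "s + t = 1"
  shows "aug_lagrangian f g A B b (s *\<^sub>R x1 + t *\<^sub>R x2) (s *\<^sub>R y1 + t *\<^sub>R y2) l \<le>
    s * aug_lagrangian f g A B b x1 y1 l + t * aug_lagrangian f g A B b x2 y2 l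
    - s * t / 2 * (norm (A x1 + B y1 - (A x2 + B y2)))\<^sup>2"
proof -
  let ?r1 = "A x1 + B y1 - b" and ?r2 = "A x2 + B y2 - b"
  have "b = s *\<^sub>R b + t *\<^sub>R b"
    using assms(7) by (simp flip: scaleR_add_left)
  then have r: "A (s *\<^sub>R x1 + t *\<^sub>R x2) + B (s *\<^sub>R y1 + t *\<^sub>R y2) - b = s *\<^sub>R ?r1 + t *\<^sub>R ?r2"
    using assms(1,2) by (simp add: linear_add linear_scale algebra_simps)
  have "f (s *\<^sub>R x1 + t *\<^sub>R x2) \<le> s * f x1 + t * f x2" "g (s *\<^sub>R y1 + t *\<^sub>R y2) \<le> s * g y1 + t * g y2"
    using assms(3-7) by (simp_all add: convex_on_def)
  moreover have "(norm (s *\<^sub>R ?r1 + t *\<^sub>R ?r2))\<^sup>2 =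
      s * (norm ?r1)\<^sup>2 + t * (norm ?r2)\<^sup>2 - s * t * (norm (A x1 + B y1 - (A x2 + B y2)))\<^sup>2"
    using norm_sq_convex_combination[OF assms(7), of ?r1 ?r2] by simp
  moreover have "l \<bullet> (s *\<^sub>R ?r1 + t *\<^sub>R ?r2) = s * (l \<bullet> ?r1) + t * (l \<bullet> ?r2)"
    by (simp only: inner_add_right inner_scaleR_right)
  ultimately show ?thesis
    unfolding aug_lagrangian_def r by (simp add: distrib_left add_divide_distrib diff_divide_distrib)
qed

text \<open>Shifting the multiplier by the residual raises the Lagrangian by the squared norm of the
  residual.\<close>

lemma saddle_point_feasible:
  assumes "(xs, ys, ls) \<in> saddle_points f g A B b"
  shows "A xs + B ys = b"
proof -
  let ?r = "A xs + B ys - b"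
  have "aug_lagrangian f g A B b xs ys (ls + ?r) \<le> aug_lagrangian f g A B b xs ys ls"
    using assms by (auto simp: saddle_points_def)
  then have "?r \<bullet> ?r \<le> 0"
    by (simp add: aug_lagrangian_def inner_add_left)
  then have "?r = 0"
    using inner_ge_zero[of ?r] inner_eq_zero_iff[of ?r] by linarith
  then show ?thesis by simp
qed

text \<open>The quadratic penalty makes every minimizer of the augmented Lagrangian feasible.\<close>

lemma solution_set_eq_argmin:
  fixes A :: "'a::real_inner \<Rightarrow> 'c::real_inner" and B :: "'b::real_inner \<Rightarrow> 'c"
  assumes lin: "linear A" "linear B" and conv: "convex_on UNIV f" "convex_on UNIV g"
    and saddle: "(xs, ys, ls) \<in> saddle_points f g A B b"
  shows "solution_set f g A B b =
    {w. aug_lagrangian f g A B b (fst w) (snd w) ls \<le> aug_lagrangian f g A B b xs ys ls}"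
    (is "_ = {w. ?L (fst w) (snd w) \<le> ?L xs ys}")
proof -
  note feas = saddle_point_feasible[OF saddle]
  have min: "?L xs ys \<le> ?L x y" for x y
    using saddle by (auto simp: saddle_points_def)
  have L_feas: "?L x y = f x + g y" if "A x + B y = b" for x y
    using that by (simp add: aug_lagrangian_def)
  have feasible: "A x + B y = b" if "?L x y \<le> ?L xs ys" for x y
  proof -
    \<comment> \<open>At the midpoint of two minimizers with different residuals the value would
      drop strictly below the minimum.\<close>
    have "?L xs ys \<le> ?L ((1/2) *\<^sub>R xs + (1/2) *\<^sub>R x) ((1/2) *\<^sub>R ys + (1/2) *\<^sub>R y)"
      by (rule min)
    also have "\<dots> \<le> 1/2 * ?L xs ys + 1/2 * ?L x y - (1/2) * (1/2) / 2 * (norm (A xs + B ys - (A x + B y)))\<^sup>2"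
      by (rule aug_lagrangian_convex_combination[OF lin conv]) simp_all
    finally have "(norm (A xs + B ys - (A x + B y)))\<^sup>2 \<le> 0"
      using that by linarith
    then show ?thesis using feas by simp
  qed
  have "(x, y) \<in> solution_set f g A B b \<longleftrightarrow> ?L x y \<le> ?L xs ys" for x y
  proof
    assume "(x, y) \<in> solution_set f g A B b"
    then have "A x + B y = b" "f x + g y \<le> f xs + g ys"
      using feas by (auto simp: solution_set_def feasible_set_def)
    then show "?L x y \<le> ?L xs ys" using feas L_feas by simp
  next
    assume *: "?L x y \<le> ?L xs ys"
    have "f x + g y \<le> f x' + g y'" if "A x' + B y' = b" for x' y'
      using * min[of x' y'] L_feas[OF that] L_feas[OF feasible[OF *]] by simp
    then show "(x, y) \<in> solution_set f g A B b"
      using feasible[OF *] by (auto simp: solution_set_def feasible_set_def)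
  qed
  then show ?thesis by auto
qed

lemma aug_lagrangian_has_derivative:
  fixes A :: "'a::real_inner \<Rightarrow> 'c::real_inner" and B :: "'b::real_inner \<Rightarrow> 'c"
  assumes "bounded_linear A" "bounded_linear B"
    and "GDERIV f (fst w) :> df" "GDERIV g (snd w) :> dg"
  shows "((\<lambda>w. aug_lagrangian f g A B b (fst w) (snd w) l) has_derivative
    (\<lambda>h. fst h \<bullet> df + snd h \<bullet> dg + l \<bullet> (A (fst h) + B (snd h))
      + (A (fst w) + B (snd w) - b) \<bullet> (A (fst h) + B (snd h)))) (at w)"
proof -
  let ?K = "\<lambda>w. A (fst w) + B (snd w)"
  have df: "((\<lambda>w. f (fst w)) has_derivative (\<lambda>h. fst h \<bullet> df)) (at w)"
    by (rule has_derivative_compose[OF has_derivative_fst[OF has_derivative_ident]])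
       (use assms(3) in \<open>simp add: gderiv_def\<close>)
  have dg: "((\<lambda>w. g (snd w)) has_derivative (\<lambda>h. snd h \<bullet> dg)) (at w)"
    by (rule has_derivative_compose[OF has_derivative_snd[OF has_derivative_ident]])
       (use assms(4) in \<open>simp add: gderiv_def\<close>)
  have "bounded_linear ?K"
    by (intro bounded_linear_add bounded_linear_compose[OF assms(1) bounded_linear_fst]
        bounded_linear_compose[OF assms(2) bounded_linear_snd])
  then have dK: "((\<lambda>w. ?K w - b) has_derivative (\<lambda>h. ?K h - 0)) (at w)"
    by (intro has_derivative_diff bounded_linear_imp_has_derivative has_derivative_const)
  have "((\<lambda>w. f (fst w) + g (snd w) + l \<bullet> (?K w - b) + 1 / 2 * ((?K w - b) \<bullet> (?K w - b)))
      has_derivative (\<lambda>h. fst h \<bullet> df + snd h \<bullet> dg + l \<bullet> (?K h - 0)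
        + 1 / 2 * ((?K w - b) \<bullet> (?K h - 0) + (?K h - 0) \<bullet> (?K w - b)))) (at w)"
    by (intro has_derivative_add df dg has_derivative_inner_right has_derivative_mult_right
        has_derivative_inner dK)
  then show ?thesis
    unfolding aug_lagrangian_def power2_norm_eq_inner
    by (rule has_derivative_eq_rhs) (simp add: fun_eq_iff inner_commute)
qed

section \<open>Limit inferior and application to the system (DS)\<close>

lemma Liminf_ereal_norm_eq_zero:
  fixes z :: "'i \<Rightarrow> 'z::real_normed_vector"
  assumes "F \<noteq> bot" "\<And>e. e > 0 \<Longrightarrow> \<exists>\<^sub>F t in F. norm (z t) < e"
  shows "Liminf F (\<lambda>t. ereal (norm (z t))) = 0"
proof (rule antisym)
  show "Liminf F (\<lambda>t. ereal (norm (z t))) \<le> 0"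
  proof (rule ccontr)
    assume "\<not> ?thesis"
    then obtain e where "0 < ereal e" "ereal e < Liminf F (\<lambda>t. ereal (norm (z t)))"
      using ereal_dense2[of 0] by (auto simp: not_le)
    then have "e > 0" "\<forall>\<^sub>F t in F. e < norm (z t)"
      by (auto dest: less_LiminfD)
    from frequently_eventually_frequently[OF assms(2)[OF this(1)] this(2)] have "\<exists>\<^sub>F t in F. False"
      by (rule frequently_elim1) auto
    then show False by simp
  qed
  show "0 \<le> Liminf F (\<lambda>t. ereal (norm (z t)))"
    by (rule Liminf_bounded) simp
qed

theorem theorem5p1:
  fixes f :: "'a::{real_inner, complete_space} \<Rightarrow> real"
    and g :: "'b::{real_inner, complete_space} \<Rightarrow> real"
    and gf :: "'a \<Rightarrow> 'a" and gg :: "'b \<Rightarrow> 'b"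
    and A :: "'a \<Rightarrow> 'c::{real_inner, complete_space}" and B :: "'b \<Rightarrow> 'c" and b :: 'c
    and l1 l2 t0 \<gamma> \<delta> :: real
    and \<beta> \<beta>' \<epsilon> \<epsilon>' :: "real \<Rightarrow> real"
    and x :: "real \<Rightarrow> 'a" and y :: "real \<Rightarrow> 'b" and l :: "real \<Rightarrow> 'c"
    and xbar :: 'a and ybar :: 'b
  assumes "bounded_linear A" and "bounded_linear B"
    and "convex_on UNIV f" and "\<And>u. GDERIV f u :> gf u" and "continuous_on UNIV gf"
    and "l1 > 0" and "l1-lipschitz_on UNIV gf"
    and "convex_on UNIV g" and "\<And>v. GDERIV g v :> gg v" and "continuous_on UNIV gg"
    and "l2 > 0" and "l2-lipschitz_on UNIV gg"
    and "saddle_points f g A B b \<noteq> {}"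
    and "t0 > 0" and "\<gamma> > 0" and "\<delta> > 0"
    and "\<And>t. t \<ge> t0 \<Longrightarrow> \<beta> t > 0" and "mono_on {t0..} \<beta>"
    and "\<And>t. t \<ge> t0 \<Longrightarrow> (\<beta> has_real_derivative \<beta>' t) (at t within {t0..})"
    and "continuous_on {t0..} \<beta>'"
    and "\<And>t. t \<ge> t0 \<Longrightarrow> \<epsilon> t \<ge> 0" and "antimono_on {t0..} \<epsilon>"
    and "\<And>t. t \<ge> t0 \<Longrightarrow> (\<epsilon> has_real_derivative \<epsilon>' t) (at t within {t0..})"
    and "continuous_on {t0..} \<epsilon>'"
    and "(\<epsilon> \<longlongrightarrow> 0) at_top"
    and "(\<integral>\<^sup>+t\<in>{t0..}. ennreal (\<epsilon> t) \<partial>lborel) < \<infinity>"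
    and "filterlim (\<lambda>t. \<beta> t * \<epsilon> t) at_top at_top"
    and "\<And>t. t \<ge> t0 \<Longrightarrow> \<beta>' t \<le> 1 / \<delta> * \<beta> t"
    and "1 / \<delta> \<le> \<gamma>"
    and "(xbar, ybar) = metric_proj (solution_set f g A B b) 0"
    and "is_DS_solution t0 \<gamma> \<delta> \<beta> \<epsilon> gf gg A B b x y l"
  shows "Liminf at_top (\<lambda>t. ereal (norm ((x t, y t) - (xbar, ybar)))) = 0 \<and>
    ((\<exists>T\<ge>t0.
        (\<forall>t\<ge>T. (x t, y t) \<in> cball 0 (sqrt ((norm xbar)\<^sup>2 + (norm ybar)\<^sup>2))) \<or>
        (\<forall>t\<ge>T. (x t, y t) \<in> - cball 0 (sqrt ((norm xbar)\<^sup>2 + (norm ybar)\<^sup>2)))) \<longrightarrow>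
     ((\<lambda>t. norm ((x t, y t) - (xbar, ybar))) \<longlongrightarrow> 0) at_top)"
proof -
  note lin = bounded_linear.linear[OF assms(1)] bounded_linear.linear[OF assms(2)]
  obtain xs ys ls where saddle: "(xs, ys, ls) \<in> saddle_points f g A B b"
    using assms(13) by auto
  define \<phi> where "\<phi> = (\<lambda>w. aug_lagrangian f g A B b (fst w) (snd w) ls)"
  define K where "K = (\<lambda>w. A (fst w) + B (snd w))"
  define d\<phi> where "d\<phi> = (\<lambda>w h. fst h \<bullet> gf (fst w) + snd h \<bullet> gg (snd w) + ls \<bullet> K h + (K w - b) \<bullet> K h)"
  have deriv: "(\<phi> has_derivative d\<phi> w) (at w)" for w
    unfolding \<phi>_def d\<phi>_def K_def by (rule aug_lagrangian_has_derivative[OF assms(1,2,4,9)])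
  have min: "\<phi> (xs, ys) \<le> \<phi> w" for w
    using saddle by (auto simp: saddle_points_def \<phi>_def)
  have conv: "convex_on UNIV \<phi>"
    unfolding convex_on_def
  proof (intro conjI ballI allI impI)
    fix v w s t assume st: "0 \<le> s" "0 \<le> t" "s + t = (1::real)"
    have "0 \<le> s * t / 2 * (norm (A (fst v) + B (snd v) - (A (fst w) + B (snd w))))\<^sup>2"
      using st by simp
    then show "\<phi> (s *\<^sub>R v + t *\<^sub>R w) \<le> s * \<phi> v + t * \<phi> w"
      using aug_lagrangian_convex_combination[OF lin assms(3,8) st, of b "fst v" "fst w" "snd v" "snd w" ls]
      by (simp add: \<phi>_def)
  qed simp
  \<comment> \<open>As a sublevel set of a continuous convex function, the solution set is closed
    and convex, so its projection of 0 is well defined.\<close>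
  have sol: "solution_set f g A B b = {w. \<phi> w \<le> \<phi> (xs, ys)}"
    using solution_set_eq_argmin[OF lin assms(3,8) saddle] by (simp add: \<phi>_def)
  have "continuous_on UNIV \<phi>"
    using deriv by (intro continuous_at_imp_continuous_on) (blast intro: has_derivative_continuous)
  then have "closed (solution_set f g A B b)"
    unfolding sol by (intro closed_Collect_le continuous_on_const)
  moreover have "convex (solution_set f g A B b)"
    unfolding sol by (rule convex_sublevel[OF conv])
  moreover have "(xs, ys) \<in> solution_set f g A B b"
    by (simp add: sol)
  ultimately have us: "(xbar, ybar) \<in> solution_set f g A B b"
    "\<And>q. q \<in> solution_set f g A B b \<Longrightarrow> norm (xbar, ybar) \<le> norm q"
    unfolding assms(30) using metric_proj_zero by blast+
  have \<phi>_us: "\<phi> (xbar, ybar) = \<phi> (xs, ys)"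
    using us(1) min[of "(xbar, ybar)"] by (simp add: sol)
  have "continuous_on {t0..} \<epsilon>"
    using assms(23) by (intro DERIV_continuous_on) auto
  from convergent_antiderivative_of_nn_integral[OF this assms(21,26)]
  obtain h H where h: "\<And>t. t \<ge> t0 \<Longrightarrow> (h has_real_derivative \<epsilon> t) (at t within {t0..})"
    "(h \<longlongrightarrow> H) at_top"
    by blast
  obtain x' x'' y' y'' l' where DS: "\<And>t. t \<ge> t0 \<Longrightarrow>
       (x has_vector_derivative x' t) (at t within {t0..}) \<and>
       (x' has_vector_derivative x'' t) (at t within {t0..}) \<and>
       (y has_vector_derivative y' t) (at t within {t0..}) \<and>
       (y' has_vector_derivative y'' t) (at t within {t0..}) \<and>
       (l has_vector_derivative l' t) (at t within {t0..}) \<and>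
       x'' t + \<gamma> *\<^sub>R x' t + \<beta> t *\<^sub>R (gf (x t) + adjoint A (l t)
         + adjoint A (A (x t) + B (y t) - b) + \<epsilon> t *\<^sub>R x t) = 0 \<and>
       y'' t + \<gamma> *\<^sub>R y' t + \<beta> t *\<^sub>R (gg (y t) + adjoint B (l t)
         + adjoint B (A (x t) + B (y t) - b) + \<epsilon> t *\<^sub>R y t) = 0 \<and>
       l' t - \<beta> t *\<^sub>R (A (x t + \<delta> *\<^sub>R x' t) + B (y t + \<delta> *\<^sub>R y' t) - b) = 0"
    using assms(31) unfolding is_DS_solution_def by blast
  define u where "u = (\<lambda>t. (x t, y t))"
  define us where "us = (xbar, ybar)"
  interpret regularized_primal_dual_flow \<phi> d\<phi> K b ls us t0 \<gamma> \<delta> H \<beta> \<beta>' \<epsilon> \<epsilon>' h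
    u "\<lambda>t. (x' t, y' t)" "\<lambda>t. (x'' t, y'' t)" l l'
  proof (rule regularized_primal_dual_flow.intro)
    show "bounded_linear K"
      unfolding K_def
      by (intro bounded_linear_add bounded_linear_compose[OF assms(1) bounded_linear_fst]
          bounded_linear_compose[OF assms(2) bounded_linear_snd])
    show "K us = b"
      using us(1) by (auto simp: K_def us_def solution_set_def feasible_set_def)
    show "\<phi> us \<le> \<phi> w" for w
      using min \<phi>_us by (simp add: us_def)
    show "norm us \<le> norm w" if "\<phi> w = \<phi> us" for w
      using that \<phi>_us by (auto simp: us_def sol intro!: us(2))
    show "\<epsilon>' t \<le> 0" if "t \<ge> t0" for t
      using antimono_on_has_real_derivative_nonpos[OF assms(22,23)] that by blast
    fix t assume t: "t \<ge> t0"
    show "(u has_vector_derivative (x' t, y' t)) (at t within {t0..})"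
      "((\<lambda>t. (x' t, y' t)) has_vector_derivative (x'' t, y'' t)) (at t within {t0..})"
      unfolding u_def using DS[OF t] by (auto intro: has_vector_derivative_Pair)
    show "(l has_vector_derivative l' t) (at t within {t0..})"
      using DS[OF t] by blast
    show "l' t = \<beta> t *\<^sub>R (K (u t + \<delta> *\<^sub>R (x' t, y' t)) - b)"
      using DS[OF t] by (simp add: K_def u_def)
    fix w :: "'a \<times> 'b"
    let ?r = "A (x t) + B (y t) - b"
    have eqs: "x'' t + \<gamma> *\<^sub>R x' t + \<beta> t *\<^sub>R (gf (x t) + adjoint A (l t) + adjoint A ?r + \<epsilon> t *\<^sub>R x t) = 0"
      "y'' t + \<gamma> *\<^sub>R y' t + \<beta> t *\<^sub>R (gg (y t) + adjoint B (l t) + adjoint B ?r + \<epsilon> t *\<^sub>R y t) = 0"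
      using DS[OF t] by blast+
    \<comment> \<open>Pairing each equation with a component of \<open>w\<close> moves the adjoints
      onto \<open>w\<close>.\<close>
    have x_eq: "fst w \<bullet> x'' t + \<gamma> * (fst w \<bullet> x' t)
      + \<beta> t * (fst w \<bullet> gf (x t) + A (fst w) \<bullet> l t + A (fst w) \<bullet> ?r + \<epsilon> t * (fst w \<bullet> x t)) = 0"
      using arg_cong[OF eqs(1), of "\<lambda>z. fst w \<bullet> z"]
      by (simp only: inner_add_right inner_scaleR_right inner_zero_right adjoint_hilbert[OF assms(1)])
    have y_eq: "snd w \<bullet> y'' t + \<gamma> * (snd w \<bullet> y' t)
      + \<beta> t * (snd w \<bullet> gg (y t) + B (snd w) \<bullet> l t + B (snd w) \<bullet> ?r + \<epsilon> t * (snd w \<bullet> y t)) = 0"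
      using arg_cong[OF eqs(2), of "\<lambda>z. snd w \<bullet> z"]
      by (simp only: inner_add_right inner_scaleR_right inner_zero_right adjoint_hilbert[OF assms(2)])
    define r where "r = ?r"
    have K_u: "K (u t) - b = r" by (simp add: K_def u_def r_def)
    \<comment> \<open>The sum of both tested equations; \<open>ls \<bullet> K w\<close> inside
      \<open>d\<phi>\<close> and \<open>(l t - ls) \<bullet> K w\<close> add up to
      \<open>l t \<bullet> K w\<close>.\<close>
    show "(x'' t, y'' t) \<bullet> w + \<gamma> * ((x' t, y' t) \<bullet> w)
      + \<beta> t * (d\<phi> (u t) w + (l t - ls) \<bullet> K w + \<epsilon> t * (u t \<bullet> w)) = 0"
      using arg_cong2[OF x_eq y_eq, of "(+)"] unfolding d\<phi>_def K_u r_def[symmetric]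
      by (simp add: K_def u_def inner_prod_def inner_add_left inner_add_right inner_diff_left
          inner_commute algebra_simps)
  qed (use conv deriv h assms in blast)+
  have Liminf: "Liminf at_top (\<lambda>t. ereal (norm (u t - us))) = 0"
    by (intro Liminf_ereal_norm_eq_zero frequently_close) simp_all
  have ball: "(x t, y t) \<in> cball 0 (sqrt ((norm xbar)\<^sup>2 + (norm ybar)\<^sup>2)) \<longleftrightarrow> norm (u t) \<le> norm us" for t
    by (simp add: u_def us_def norm_Pair)
  have "((\<lambda>t. norm (u t - us)) \<longlongrightarrow> 0) at_top"
    if "\<forall>t\<ge>T. norm (u t) \<le> norm us" for T
  proof (rule order_tendstoI)
    show "\<forall>\<^sub>F t in at_top. a < norm (u t - us)" if "a < 0" for a
      using that by (intro always_eventually) (auto intro: less_le_trans)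
    show "\<forall>\<^sub>F t in at_top. norm (u t - us) < e" if "0 < e" for e
      using eventually_close_if_in_ball[OF that] eventually_ge_at_top[of T]
      by eventually_elim (use \<open>\<forall>t\<ge>T. norm (u t) \<le> norm us\<close> in blast)
  qed
  moreover have "((\<lambda>t. norm (u t - us)) \<longlongrightarrow> 0) at_top"
    if "\<forall>t\<ge>T. norm us < norm (u t)" for T
    using that by (intro tendsto_of_outside_ball) (auto simp: eventually_at_top_linorder)
  ultimately show ?thesis
    using Liminf unfolding Compl_iff ball not_le u_def[symmetric] us_def[symmetric]
    unfolding u_def by blast
qed

end
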